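(* Let $H$ be an isomorphism class of groups. Then $H\in\mathscr{R}$ if and only if $H$ is the isomorphism class of a subgroup of a group in $\mathscr{M}$.
   Context: $\mathscr{R}$ is the smallest non-empty class of isomorphism classes of groups which is closed under the following three operations (given as operations on groups, inducing operations on isomorphism classes): (1) taking subgroups; (2) forming the standard restricted wreath product with $\mathbf{Z}$, i.e. $K\mapsto K\wr\mathbf{Z}$; (3) forming bounded direct sums, i.e. (finite or) countable direct sums of groups in the class for which there is a universal bound on the derived lengths of the summands. The standard restricted wreath product $A\wr T$ is the semidirect product $B\rtimes T$ with $B=\bigoplus_{t\in T}A$, where $T$ acts on $B$ by right multiplication on the index of the direct sum. Define $G_0=1$ (the trivial group) and inductively $G_n=\bigoplus_{k\in\mathbf{Z}}(G_{n-1}\wr\mathbf{Z})$ for all positive integers $n$. Let $\mathscr{M}=\{G_n \mid n\in\mathbf{N}\}$, where $0\in\mathbf{N}$. *)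

theory Defs
  imports "HOL-Algebra.Algebra" "HOL-Library.Extended_Nat"
begin

section \<open>Semidirect and wreath products\<close>

text \<open>The pair (b, t) stands for the product bt, and \<open>act t b\<close> for the conjugate of b by t
  with t on the left (so \<open>act\<close> is a left action), i.e. (bt)(cu) = (b \<open>act t c\<close>)(tu).\<close>

definition semidirect_product ::
  "('a, 'm) monoid_scheme \<Rightarrow> ('t, 'n) monoid_scheme \<Rightarrow> ('t \<Rightarrow> 'a \<Rightarrow> 'a) \<Rightarrow> ('a \<times> 't) monoid"
  where "semidirect_product B T act =
    \<lparr> carrier = carrier B \<times> carrier T,
      monoid.mult = (\<lambda>(b, t) (c, u). (b \<otimes>\<^bsub>B\<^esub> act t c, t \<otimes>\<^bsub>T\<^esub> u)),
      one = (\<one>\<^bsub>B\<^esub>, \<one>\<^bsub>T\<^esub>) \<rparr>"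

text \<open>The right action of t on the direct sum moves the entry at index s to index st.
  The left action used here is that of the inverse of t: the entry at index st moves to
  index s.\<close>

definition wreath :: "('a, 'm) monoid_scheme \<Rightarrow> ('t, 'n) monoid_scheme \<Rightarrow> (('t \<Rightarrow> 'a) \<times> 't) monoid"
  where "wreath A T =
    semidirect_product (sum_group (carrier T) (\<lambda>_. A)) T
      (\<lambda>t b. \<lambda>s\<in>carrier T. b (s \<otimes>\<^bsub>T\<^esub> t))"

lemma group_semidirect_product:
  assumes "group B" "group T"
    and closed: "\<And>t b. t \<in> carrier T \<Longrightarrow> b \<in> carrier B \<Longrightarrow> act t b \<in> carrier B"
    and hom: "\<And>t b c. t \<in> carrier T \<Longrightarrow> b \<in> carrier B \<Longrightarrow> c \<in> carrier B \<Longrightarrow>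
                act t (b \<otimes>\<^bsub>B\<^esub> c) = act t b \<otimes>\<^bsub>B\<^esub> act t c"
    and one: "\<And>b. b \<in> carrier B \<Longrightarrow> act \<one>\<^bsub>T\<^esub> b = b"
    and mult: "\<And>t u b. t \<in> carrier T \<Longrightarrow> u \<in> carrier T \<Longrightarrow> b \<in> carrier B \<Longrightarrow>
                act (t \<otimes>\<^bsub>T\<^esub> u) b = act t (act u b)"
  shows "group (semidirect_product B T act)"
proof -
  interpret B: group B by fact
  interpret T: group T by fact
  show ?thesis
  proof (rule groupI, goal_cases)
    case (5 x)
    then obtain b t where x: "x = (b, t)" "b \<in> carrier B" "t \<in> carrier T"
      by (auto simp: semidirect_product_def)
    show ?case
      by (rule bexI[of _ "(act (inv\<^bsub>T\<^esub> t) (inv\<^bsub>B\<^esub> b), inv\<^bsub>T\<^esub> t)"])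
        (use x in \<open>auto simp: semidirect_product_def closed hom[symmetric],
          metis B.inv_closed B.l_inv B.one_closed B.r_cancel_one T.inv_closed closed hom B.l_one\<close>)
  qed (auto simp: semidirect_product_def closed hom one mult B.m_assoc T.m_assoc)
qed

lemma group_wreath:
  assumes "group A" "group T"
  shows "group (wreath A T)"
proof -
  interpret A: group A by fact
  interpret T: group T by fact
  show ?thesis unfolding wreath_def
  proof (rule group_semidirect_product, goal_cases)
    case (3 t b)
    have "finite ((\<lambda>s. s \<otimes>\<^bsub>T\<^esub> inv\<^bsub>T\<^esub> t) ` {i \<in> carrier T. b i \<noteq> \<one>\<^bsub>A\<^esub>})"
      using 3 assms by (auto simp: carrier_sum_group)
    moreover have "{i \<in> carrier T. b (i \<otimes>\<^bsub>T\<^esub> t) \<noteq> \<one>\<^bsub>A\<^esub>}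
        \<subseteq> (\<lambda>s. s \<otimes>\<^bsub>T\<^esub> inv\<^bsub>T\<^esub> t) ` {i \<in> carrier T. b i \<noteq> \<one>\<^bsub>A\<^esub>}"
    proof
      fix i assume "i \<in> {i \<in> carrier T. b (i \<otimes>\<^bsub>T\<^esub> t) \<noteq> \<one>\<^bsub>A\<^esub>}"
      then show "i \<in> (\<lambda>s. s \<otimes>\<^bsub>T\<^esub> inv\<^bsub>T\<^esub> t) ` {i \<in> carrier T. b i \<noteq> \<one>\<^bsub>A\<^esub>}"
        using 3 by (intro image_eqI[of _ _ "i \<otimes>\<^bsub>T\<^esub> t"]) (auto simp: T.m_assoc)
    qed
    ultimately have "finite {i \<in> carrier T. b (i \<otimes>\<^bsub>T\<^esub> t) \<noteq> \<one>\<^bsub>A\<^esub>}"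
      by (rule rev_finite_subset)
    then show ?case
      using 3 assms by (auto simp: carrier_sum_group PiE_iff cong: conj_cong)
  qed (use assms in \<open>auto simp: carrier_sum_group PiE_iff T.m_assoc fun_eq_iff extensional_def restrict_def\<close>)
qed


section \<open>Isomorphism classes\<close>

text \<open>The type variable \<open>'u\<close> plays the role of the universe of sets from which the carriers
  are taken. For infinite \<open>'u\<close>, every group obtained below from groups with carriers in \<open>'u\<close>
  is again isomorphic to one with carrier in \<open>'u\<close>.\<close>

definition iso_class :: "('a, 'm) monoid_scheme \<Rightarrow> 'u monoid set"
  where "iso_class G = {K. group K \<and> G \<cong> K}"

definition iso_classes :: "'u monoid set set"
  where "iso_classes = {iso_class G | G :: 'u monoid. group G}"


section \<open>The class \<open>\<R>\<close>\<close>

definition derived_length :: "('a, 'm) monoid_scheme \<Rightarrow> enat"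
  where "derived_length G = Inf {enat n | n. (derived G ^^ n) (carrier G) = {\<one>\<^bsub>G\<^esub>}}"

text \<open>For a set C of isomorphism classes, \<open>\<Union>C\<close> is the set of all groups (with carrier
  in \<open>'u\<close>) whose isomorphism class is in C.\<close>

definition closed_subgroups :: "'u monoid set set \<Rightarrow> bool"
  where "closed_subgroups C \<longleftrightarrow>
    (\<forall>K\<in>\<Union>C. \<forall>S. subgroup S K \<longrightarrow> iso_class (K\<lparr>carrier := S\<rparr>) \<in> C)"

definition closed_wreath_int :: "'u monoid set set \<Rightarrow> bool"
  where "closed_wreath_int C \<longleftrightarrow> (\<forall>K\<in>\<Union>C. iso_class (wreath K integer_group) \<in> C)"

definition closed_bounded_sums :: "'u monoid set set \<Rightarrow> bool"
  where "closed_bounded_sums C \<longleftrightarrow>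
    (\<forall>(I :: nat set) K. (\<forall>i\<in>I. K i \<in> \<Union>C) \<and> (\<exists>d. \<forall>i\<in>I. derived_length (K i) \<le> enat d)
       \<longrightarrow> iso_class (sum_group I K) \<in> C)"

definition class_R :: "'u monoid set set"
  where "class_R = \<Inter>{C. C \<subseteq> iso_classes \<and> C \<noteq> {} \<and>
    closed_subgroups C \<and> closed_wreath_int C \<and> closed_bounded_sums C}"


section \<open>The family \<open>\<M>\<close>\<close>

text \<open>The elements of \<open>\<Oplus>\<^sub>k (G \<wreath> \<int>)\<close> are functions on the integers with values in pairs of
  a function from the integers to the elements of G and an integer. The following type is closed
  under this construction, so all the groups \<open>G\<^sub>n\<close> can be defined on it; the bijection \<open>Node\<close>
  onto its image transports the group structure.\<close>

datatype tower = Triv | Node "int \<Rightarrow> (int \<Rightarrow> tower) \<times> int"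

primrec tower_group :: "nat \<Rightarrow> tower monoid"
  where
    "tower_group 0 = singleton_group Triv"
  | "tower_group (Suc n) =
      image_group Node (sum_group UNIV (\<lambda>k::int. wreath (tower_group n) integer_group))"

definition class_M :: "tower monoid set"
  where "class_M = range tower_group"

lemma group_tower_group: "group (tower_group n)"
proof (induction n)
  case (Suc n)
  then have "group (sum_group UNIV (\<lambda>k::int. wreath (tower_group n) integer_group))"
    by (simp add: group_wreath)
  then show ?case
    by (simp add: group.inj_imp_image_group_is_group inj_on_def)
qed simp

end

theory Submission
  imports Defs
begin

text \<open>Write \<open>G\<^sub>n\<close> for the group \<open>tower_group n\<close>. Both implications reduce to facts about embeddings
  of groups, because an isomorphism class is that of a subgroup of \<open>G\<^sub>n\<close> exactly if its members
  embed in \<open>G\<^sub>n\<close>.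

  Every class with the closure properties contains the class of each \<open>G\<^sub>n\<close>
  (\<open>tower_group_mem_closed\<close>): \<open>G\<^sub>n\<close> is solvable of derived length at most n, since a wreath product
  with \<open>\<int>\<close> raises the derived length by at most one and a direct sum does not raise it. Hence the
  direct sum that produces \<open>G\<^sub>n\<^sub>+\<^sub>1\<close> is bounded.

  Conversely, the classes of groups that embed in some \<open>G\<^sub>n\<close> have the closure properties
  (\<open>tower_classes_closed\<close>). Subgroups are immediate, and \<open>K \<wreath> \<int>\<close> embeds in \<open>G\<^sub>n\<^sub>+\<^sub>1\<close> if \<open>K\<close> embeds in
  \<open>G\<^sub>n\<close>. The difficulty is bounded direct sums: the summands may need arbitrarily large n. It is
  removed by showing that the derived length alone determines how far up the tower one has to go:
  a subgroup of any \<open>G\<^sub>n\<close> of derived length at most d embeds in \<open>G\<^sub>d\<close> (\<open>tower_group_absorbs\<close>). A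
  bounded direct sum then embeds in a direct sum of copies of one \<open>G\<^sub>d\<close>, which embeds in \<open>G\<^sub>d\<close>.

  The last claim is proved by induction on n, and its heart is a subgroup S of \<open>A \<wreath> \<int>\<close>
  (\<open>wreath_int_subgroup_embeds\<close>). If S lies in the base group, it embeds in the direct sum of
  its coordinate projections, and those are covered by induction. Otherwise S contains an element x
  that shifts the coordinates by some m > 0. For h in the base part of S, a high power y of x
  moves the finite support of h so far that the commutator of h and y agrees with h at any given
  coordinate. So the coordinate projections of the base part of S are already projections of the
  derived subgroup of S, and their derived length is at most d - 1: one level of the tower is saved.
  Moreover S is generated by its base part and one x with m minimal. Conjugation by
  powers of x brings every coordinate into the window 0, ..., m - 1, so S embeds in the wreath product
  with \<open>\<int>\<close> of the direct sum of the m projections to this window.\<close>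


section \<open>Embeddings of groups\<close>

text \<open>The two groups may have elements of different types, which is what allows comparing the groups
  of the tower with arbitrary ones.\<close>

definition embeds :: "('a, 'm) monoid_scheme \<Rightarrow> ('b, 'n) monoid_scheme \<Rightarrow> bool"
  where "embeds G H \<longleftrightarrow> mon G H \<noteq> {}"

lemma embedsI:
  assumes "group G" "group H" "f \<in> hom G H"
    and "\<And>x. x \<in> carrier G \<Longrightarrow> f x = \<one>\<^bsub>H\<^esub> \<Longrightarrow> x = \<one>\<^bsub>G\<^esub>"
  shows "embeds G H"
proof -
  interpret group_hom G H f
    using assms by (simp add: group_hom_def group_hom_axioms_def)
  have "inj_on f (carrier G)"
    using assms(4) by (simp add: inj_on_one_iff)
  then show ?thesis
    using assms(3) unfolding embeds_def mon_def by blast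
qed

lemma embedsE:
  assumes "embeds G H" "group G" "group H"
  obtains f where "f \<in> hom G H" "inj_on f (carrier G)"
    "\<And>x. x \<in> carrier G \<Longrightarrow> f x = \<one>\<^bsub>H\<^esub> \<longleftrightarrow> x = \<one>\<^bsub>G\<^esub>"
proof -
  from assms obtain f where f: "f \<in> hom G H" "inj_on f (carrier G)"
    by (auto simp: embeds_def mon_def)
  interpret group_hom G H f
    using assms f by (simp add: group_hom_def group_hom_axioms_def)
  show ?thesis
    by (rule that[of f]) (use f inj_on_one_iff in \<open>auto\<close>)
qed

lemma embeds_refl: "embeds G G"
  using id_iso[of G] by (auto simp: embeds_def iso_iff_mon_epi)

lemma embeds_trans: "embeds G H \<Longrightarrow> embeds H K \<Longrightarrow> embeds G K"
  by (auto simp: embeds_def) (blast dest: mon_compose)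

lemma iso_imp_embeds: "G \<cong> H \<Longrightarrow> embeds G H"
  by (auto simp: embeds_def is_iso_def iso_iff_mon_epi)

lemma subgroup_embeds: "subgroup S G \<Longrightarrow> embeds (G\<lparr>carrier := S\<rparr>) G"
  unfolding embeds_def mon_def hom_def
  by (auto intro!: exI[of _ "\<lambda>x. x"] dest: subgroup.mem_carrier)

lemma hom_from_subset: "f \<in> hom G H \<Longrightarrow> S \<subseteq> carrier G \<Longrightarrow> f \<in> hom (G\<lparr>carrier := S\<rparr>) H"
  unfolding hom_def by fastforce

text \<open>Translates embeddings back to the subgroups that the main statement speaks about.\<close>

lemma embeds_imp_iso_subgroup:
  assumes "embeds G H" "group G" "group H"
  obtains S where "subgroup S H" "G \<cong> H\<lparr>carrier := S\<rparr>"
proof -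
  from assms obtain f where f: "f \<in> hom G H" "inj_on f (carrier G)"
    by (auto simp: embeds_def mon_def)
  interpret group_hom G H f
    using assms f by (simp add: group_hom_def group_hom_axioms_def)
  have "f \<in> iso G (H\<lparr>carrier := f ` carrier G\<rparr>)"
    using f by (auto simp: iso_def hom_def bij_betw_def)
  then show ?thesis
    using that[OF img_is_subgroup] by (auto simp: is_iso_def)
qed


section \<open>Embeddings into direct sums\<close>

lemma hom_into_sum_group:
  assumes "\<And>j. j \<in> J \<Longrightarrow> group (F j)" "\<And>j. j \<in> J \<Longrightarrow> f j \<in> hom G (F j)"
    and "\<And>g. g \<in> carrier G \<Longrightarrow> finite {j \<in> J. f j g \<noteq> \<one>\<^bsub>F j\<^esub>}"
  shows "(\<lambda>g. \<lambda>j\<in>J. f j g) \<in> hom G (sum_group J F)"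
proof (rule homI)
  fix g assume g: "g \<in> carrier G"
  have "{j \<in> J. restrict (\<lambda>j. f j g) J j \<noteq> \<one>\<^bsub>F j\<^esub>} = {j \<in> J. f j g \<noteq> \<one>\<^bsub>F j\<^esub>}"
    by auto
  then show "(\<lambda>j\<in>J. f j g) \<in> carrier (sum_group J F)"
    using g assms by (auto simp: carrier_sum_group hom_def Pi_def)
next
  fix g h assume "g \<in> carrier G" "h \<in> carrier G"
  then show "(\<lambda>j\<in>J. f j (g \<otimes>\<^bsub>G\<^esub> h)) = (\<lambda>j\<in>J. f j g) \<otimes>\<^bsub>sum_group J F\<^esub> (\<lambda>j\<in>J. f j h)"
    using assms(2) by (auto simp: hom_def)
qed

lemma restrict_eq_one_sum_group:
  "(\<lambda>j\<in>J. f j) = \<one>\<^bsub>sum_group J F\<^esub> \<longleftrightarrow> (\<forall>j\<in>J. f j = \<one>\<^bsub>F j\<^esub>)"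
proof
  assume *: "(\<lambda>j\<in>J. f j) = \<one>\<^bsub>sum_group J F\<^esub>"
  show "\<forall>j\<in>J. f j = \<one>\<^bsub>F j\<^esub>"
  proof
    fix j assume "j \<in> J"
    then show "f j = \<one>\<^bsub>F j\<^esub>"
      using fun_cong[OF *, of j] by simp
  qed
qed (auto intro: restrict_ext)

text \<open>The general device for mapping into a direct sum: it suffices to give the coordinates, as
  homomorphisms whose kernels intersect trivially.\<close>

lemma embeds_sum_group:
  assumes "group G" "\<And>j. j \<in> J \<Longrightarrow> group (F j)" "\<And>j. j \<in> J \<Longrightarrow> f j \<in> hom G (F j)"
    and "\<And>g. g \<in> carrier G \<Longrightarrow> finite {j \<in> J. f j g \<noteq> \<one>\<^bsub>F j\<^esub>}"
    and ker: "\<And>g. g \<in> carrier G \<Longrightarrow> (\<And>j. j \<in> J \<Longrightarrow> f j g = \<one>\<^bsub>F j\<^esub>) \<Longrightarrow> g = \<one>\<^bsub>G\<^esub>"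
  shows "embeds G (sum_group J F)"
proof (rule embedsI[OF assms(1) _ hom_into_sum_group[of J F f G]])
  fix g assume "g \<in> carrier G" "(\<lambda>j\<in>J. f j g) = \<one>\<^bsub>sum_group J F\<^esub>"
  then show "g = \<one>\<^bsub>G\<^esub>"
    using ker[of g] by (simp only: restrict_eq_one_sum_group)
qed (use assms in auto)

lemma proj_hom_sum_group:
  assumes "\<And>i. i \<in> I \<Longrightarrow> group (F i)" "i \<in> I"
  shows "(\<lambda>b. b i) \<in> hom (sum_group I F) (F i)"
  using assms by (auto simp: hom_def carrier_sum_group)

lemma finite_support_sum_group:
  assumes "\<And>i. i \<in> I \<Longrightarrow> group (F i)" "b \<in> carrier (sum_group I F)"
  shows "finite {i \<in> I. b i \<noteq> \<one>\<^bsub>F i\<^esub>}"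
  using assms by (auto simp: carrier_sum_group)

lemma sum_group_eq_oneI:
  assumes "\<And>i. i \<in> I \<Longrightarrow> group (F i)" "b \<in> carrier (sum_group I F)"
    and "\<And>i. i \<in> I \<Longrightarrow> b i = \<one>\<^bsub>F i\<^esub>"
  shows "b = \<one>\<^bsub>sum_group I F\<^esub>"
  using assms by (auto simp: carrier_sum_group PiE_iff extensional_def)

lemma const_one_hom: "group H \<Longrightarrow> (\<lambda>_. \<one>\<^bsub>H\<^esub>) \<in> hom G H"
  by (auto simp: hom_def group.is_monoid monoid.one_closed)

text \<open>The case of an index map between different types is needed because the bounded sums are indexed by
  natural numbers and the sums in the tower by integers.\<close>

lemma sum_group_embeds_reindex:
  assumes F: "\<And>i. i \<in> I \<Longrightarrow> group (F i)" and Y: "group Y"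
    and emb: "\<And>i. i \<in> I \<Longrightarrow> embeds (F i) Y" and "inj_on e I" "e ` I \<subseteq> J"
  shows "embeds (sum_group I F) (sum_group J (\<lambda>_. Y))"
proof -
  have "\<forall>i\<in>I. \<exists>f. f \<in> hom (F i) Y \<and> (\<forall>x\<in>carrier (F i). f x = \<one>\<^bsub>Y\<^esub> \<longleftrightarrow> x = \<one>\<^bsub>F i\<^esub>)"
    using embedsE[OF emb F Y] by (metis (no_types, lifting))
  then obtain f where f: "\<And>i. i \<in> I \<Longrightarrow> f i \<in> hom (F i) Y"
    "\<And>i x. i \<in> I \<Longrightarrow> x \<in> carrier (F i) \<Longrightarrow> f i x = \<one>\<^bsub>Y\<^esub> \<longleftrightarrow> x = \<one>\<^bsub>F i\<^esub>"
    by metis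
  \<comment> \<open>Coordinates outside the range of \<open>e\<close> are filled with the trivial homomorphism.\<close>
  define g where "g j b = (if j \<in> e ` I then f (inv_into I e j) (b (inv_into I e j)) else \<one>\<^bsub>Y\<^esub>)"
    for j b
  have g_e: "g (e i) b = f i (b i)" if "i \<in> I" for i b
    using that assms(4) by (auto simp: g_def)
  have car: "b i \<in> carrier (F i)" if "b \<in> carrier (sum_group I F)" "i \<in> I" for b i
    using that F by (auto simp: carrier_sum_group)
  show ?thesis
  proof (rule embeds_sum_group[where f = g])
    fix j assume "j \<in> J"
    show "g j \<in> hom (sum_group I F) Y"
    proof (cases "j \<in> e ` I")
      case True
      then obtain i where i: "i \<in> I" "j = e i" by auto
      have "g j = f i \<circ> (\<lambda>b. b i)"
        using g_e[OF i(1)] i(2) by auto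
      moreover have "f i \<circ> (\<lambda>b. b i) \<in> hom (sum_group I F) Y"
        using hom_compose[OF proj_hom_sum_group[of I F i] f(1)[OF i(1)]] F i by simp
      ultimately show ?thesis by simp
    qed (use const_one_hom[OF Y] in \<open>auto simp: g_def[abs_def]\<close>)
  next
    fix b assume b: "b \<in> carrier (sum_group I F)"
    have "{j \<in> J. g j b \<noteq> \<one>\<^bsub>Y\<^esub>} \<subseteq> e ` {i \<in> I. b i \<noteq> \<one>\<^bsub>F i\<^esub>}"
    proof
      fix j assume "j \<in> {j \<in> J. g j b \<noteq> \<one>\<^bsub>Y\<^esub>}"
      moreover from this obtain i where "i \<in> I" "j = e i"
        by (auto simp: g_def split: if_splits)
      ultimately show "j \<in> e ` {i \<in> I. b i \<noteq> \<one>\<^bsub>F i\<^esub>}"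
        using g_e f(2) car[OF b] by auto
    qed
    moreover have "finite {i \<in> I. b i \<noteq> \<one>\<^bsub>F i\<^esub>}"
      using finite_support_sum_group[OF F b] by simp
    ultimately show "finite {j \<in> J. g j b \<noteq> \<one>\<^bsub>Y\<^esub>}"
      by (meson finite_imageI finite_subset)
  next
    fix b assume b: "b \<in> carrier (sum_group I F)" and *: "\<And>j. j \<in> J \<Longrightarrow> g j b = \<one>\<^bsub>Y\<^esub>"
    show "b = \<one>\<^bsub>sum_group I F\<^esub>"
    proof (rule sum_group_eq_oneI[OF F b])
      fix i assume i: "i \<in> I"
      then show "b i = \<one>\<^bsub>F i\<^esub>"
        using *[of "e i"] assms(5) g_e[OF i] f(2)[OF i] car[OF b] by auto
    qed
  qed (use F Y in auto)
qed

lemma embeds_into_sum_group: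
  assumes "group F" "j \<in> J"
  shows "embeds F (sum_group J (\<lambda>_. F))"
proof (rule embeds_sum_group[where f = "\<lambda>i x. if i = j then x else \<one>\<^bsub>F\<^esub>"])
  fix i
  show "(\<lambda>x. if i = j then x else \<one>\<^bsub>F\<^esub>) \<in> hom F F"
    using const_one_hom[OF assms(1), of F] by (auto simp: hom_def)
next
  fix g
  show "finite {i \<in> J. (if i = j then g else \<one>\<^bsub>F\<^esub>) \<noteq> \<one>\<^bsub>F\<^esub>}"
    by (rule finite_subset[of _ "{j}"]) auto
qed (use assms in \<open>auto split: if_splits, metis\<close>)

text \<open>A bijection between the integers and pairs of integers flattens the double sum.\<close>

lemma nested_sum_group_embeds:
  assumes A: "group A"
  shows "embeds (sum_group UNIV (\<lambda>_::int. sum_group UNIV (\<lambda>_::int. A))) (sum_group UNIV (\<lambda>_::int. A))"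
    (is "embeds (sum_group UNIV (\<lambda>_::int. ?S)) ?S")
proof -
  define p where "p j = map_prod int_decode int_decode (prod_decode (int_encode j))" for j
  have "inj p"
    by (rule inj_on_inverseI[where g = "\<lambda>x. int_decode (prod_encode (map_prod int_encode int_encode x))"])
      (simp add: p_def prod.map_comp o_def)
  have surj: "\<exists>j. p j = (i, k)" for i k
    by (rule exI[of _ "int_decode (prod_encode (int_encode i, int_encode k))"]) (simp add: p_def)
  have S: "group ?S" using A by simp
  have hom1: "(\<lambda>b. b i) \<in> hom (sum_group UNIV (\<lambda>_::int. ?S)) ?S" for i
    by (rule proj_hom_sum_group) (use S in auto)
  have hom2: "(\<lambda>c. c k) \<in> hom ?S A" for k
    by (rule proj_hom_sum_group) (use A in auto)
  show ?thesis
  proof (rule embeds_sum_group[where f = "\<lambda>j b. b (fst (p j)) (snd (p j))"])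
    show "(\<lambda>b. b (fst (p j)) (snd (p j))) \<in> hom (sum_group UNIV (\<lambda>_. ?S)) A" for j
      using hom_compose[OF hom1 hom2] by (simp add: o_def)
  next
    fix b assume b: "b \<in> carrier (sum_group UNIV (\<lambda>_::int. ?S))"
    then have bi: "b i \<in> carrier ?S" for i
      using hom1 by (auto simp: hom_def)
    let ?T = "SIGMA i:{i. b i \<noteq> \<one>\<^bsub>?S\<^esub>}. {k. b i k \<noteq> \<one>\<^bsub>A\<^esub>}"
    have "finite ?T"
      using finite_support_sum_group[OF S b] finite_support_sum_group[OF A bi] by auto
    moreover have "{j. b (fst (p j)) (snd (p j)) \<noteq> \<one>\<^bsub>A\<^esub>} \<subseteq> p -` ?T"
    proof
      fix j assume "j \<in> {j. b (fst (p j)) (snd (p j)) \<noteq> \<one>\<^bsub>A\<^esub>}"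
      then have *: "b (fst (p j)) (snd (p j)) \<noteq> \<one>\<^bsub>A\<^esub>" by simp
      then have "b (fst (p j)) \<noteq> \<one>\<^bsub>?S\<^esub>"
        using one_sum_group[of UNIV "\<lambda>_. A"] by (metis UNIV_I restrict_apply')
      with * show "j \<in> p -` ?T"
        by (simp add: mem_Sigma_iff[of "fst (p j)" "snd (p j)", simplified] del: one_sum_group)
    qed
    ultimately show "finite {j \<in> UNIV. b (fst (p j)) (snd (p j)) \<noteq> \<one>\<^bsub>A\<^esub>}"
      using finite_vimageI[OF _ \<open>inj p\<close>] by (auto intro: finite_subset)
    assume *: "\<And>j. j \<in> UNIV \<Longrightarrow> b (fst (p j)) (snd (p j)) = \<one>\<^bsub>A\<^esub>"
    have "b i k = \<one>\<^bsub>A\<^esub>" for i k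
      using surj[of i k] * by (metis UNIV_I fst_conv snd_conv)
    then have "b i = \<one>\<^bsub>?S\<^esub>" for i
      by (intro sum_group_eq_oneI[OF A bi]) auto
    then show "b = \<one>\<^bsub>sum_group UNIV (\<lambda>_. ?S)\<^esub>"
      by (intro sum_group_eq_oneI[OF S b]) auto
  qed (use A in auto)
qed


section \<open>Wreath products with the integers\<close>

lemma carrier_wreath_int:
  assumes "group A"
  shows "carrier (wreath A integer_group) =
    {(b, t). (\<forall>s. b s \<in> carrier A) \<and> finite {s. b s \<noteq> \<one>\<^bsub>A\<^esub>}}"
  using assms by (auto simp: wreath_def semidirect_product_def carrier_sum_group)

lemma mult_wreath_int:
  "(b, t) \<otimes>\<^bsub>wreath A integer_group\<^esub> (c, u) = (\<lambda>s. b s \<otimes>\<^bsub>A\<^esub> c (s + t), t + u)"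
  by (simp add: wreath_def semidirect_product_def restrict_UNIV)

lemma one_wreath_int: "\<one>\<^bsub>wreath A integer_group\<^esub> = (\<lambda>_. \<one>\<^bsub>A\<^esub>, 0)"
  by (simp add: wreath_def semidirect_product_def restrict_UNIV)

lemma snd_hom_wreath_int: "snd \<in> hom (wreath A integer_group) integer_group"
  by (auto simp: hom_def wreath_def semidirect_product_def)

lemma fst_mult_wreath_int:
  "fst (x \<otimes>\<^bsub>wreath A integer_group\<^esub> y) s = fst x s \<otimes>\<^bsub>A\<^esub> fst y (s + snd x)"
  by (cases x; cases y) (simp add: mult_wreath_int)

lemma snd_mult_wreath_int:
  "snd (x \<otimes>\<^bsub>wreath A integer_group\<^esub> y) = snd x + snd y"
  by (cases x; cases y) (simp add: mult_wreath_int)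

lemma fst_wreath_int_closed:
  "group A \<Longrightarrow> x \<in> carrier (wreath A integer_group) \<Longrightarrow> fst x s \<in> carrier A"
  by (auto simp: carrier_wreath_int)

text \<open>Comparing the coordinates at \<open>s\<close> in \<open>zy = yh\<close> shows that the entry of the conjugate \<open>z\<close> at \<open>s\<close>
  is conjugate in \<open>A\<close> to the entry of \<open>h\<close> at \<open>s + snd y\<close>. Supports are all that is needed below, so
  the lemma only records which entries are trivial.\<close>

lemma conj_wreath_int:
  assumes A: "group A" and y: "y \<in> carrier (wreath A integer_group)"
    and h: "h \<in> carrier (wreath A integer_group)" "snd h = 0"
    and z_def: "z = y \<otimes>\<^bsub>wreath A integer_group\<^esub> h \<otimes>\<^bsub>wreath A integer_group\<^esub> inv\<^bsub>wreath A integer_group\<^esub> y"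
  shows "z \<in> carrier (wreath A integer_group)" "snd z = 0"
    "fst z s = \<one>\<^bsub>A\<^esub> \<longleftrightarrow> fst h (s + snd y) = \<one>\<^bsub>A\<^esub>"
proof -
  interpret A: group A by fact
  interpret W: group "wreath A integer_group"
    using A by (simp add: group_wreath)
  show z: "z \<in> carrier (wreath A integer_group)"
    using y h by (simp add: z_def)
  have zy: "z \<otimes>\<^bsub>wreath A integer_group\<^esub> y = y \<otimes>\<^bsub>wreath A integer_group\<^esub> h"
    using y h by (simp add: z_def W.m_assoc)
  from arg_cong[OF this, of snd] show snd_z: "snd z = 0"
    using h by (simp add: snd_mult_wreath_int)
  have "fst z s \<otimes>\<^bsub>A\<^esub> fst y s = fst y s \<otimes>\<^bsub>A\<^esub> fst h (s + snd y)"
    using arg_cong[OF zy, of "\<lambda>x. fst x s"] snd_z by (simp add: fst_mult_wreath_int)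
  then show "fst z s = \<one>\<^bsub>A\<^esub> \<longleftrightarrow> fst h (s + snd y) = \<one>\<^bsub>A\<^esub>"
    using fst_wreath_int_closed[OF A] y h z
    by (metis A.l_cancel_one A.r_cancel_one)
qed

definition wreath_base :: "('a, 'm) monoid_scheme \<Rightarrow> ((int \<Rightarrow> 'a) \<times> int) set"
  where "wreath_base A = {g \<in> carrier (wreath A integer_group). snd g = 0}"

lemma subgroup_wreath_base:
  assumes "group A"
  shows "subgroup (wreath_base A) (wreath A integer_group)"
proof -
  interpret group_hom "wreath A integer_group" integer_group snd
    using snd_hom_wreath_int assms by (simp add: group_hom_def group_hom_axioms_def group_wreath)
  show ?thesis
    using subgroup_kernel by (simp add: wreath_base_def kernel_def)
qed

text \<open>The quotient by the base group is \<open>\<int>\<close>, which is abelian.\<close>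

lemma derived_subset_wreath_base:
  assumes "group A" and S: "S \<subseteq> carrier (wreath A integer_group)"
  shows "derived (wreath A integer_group) S \<subseteq> wreath_base A"
proof -
  interpret group_hom "wreath A integer_group" integer_group snd
    using snd_hom_wreath_int assms by (simp add: group_hom_def group_hom_axioms_def group_wreath)
  have "snd ` derived (wreath A integer_group) S = {0}"
    using derived_img[OF S] comm_group.derived_eq_singleton[OF abelian_integer_group, of "snd ` S"]
    by simp
  then show ?thesis
    using G.derived_in_carrier[OF S] by (auto simp: wreath_base_def)
qed

text \<open>On the whole wreath product a coordinate is not a homomorphism, because the shift by the second
  component interferes.\<close>

lemma coord_hom_wreath_base:
  assumes "group A" "N \<subseteq> wreath_base A"
  shows "(\<lambda>x. fst x s) \<in> hom ((wreath A integer_group)\<lparr>carrier := N\<rparr>) A"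
  using assms fst_wreath_int_closed[OF assms(1)]
  by (force simp: hom_def wreath_base_def fst_mult_wreath_int)

lemma wreath_base_eq_oneI:
  assumes "x \<in> wreath_base A" "\<And>s. fst x s = \<one>\<^bsub>A\<^esub>"
  shows "x = \<one>\<^bsub>wreath A integer_group\<^esub>"
  using assms by (cases x) (auto simp: wreath_base_def one_wreath_int)

lemma wreath_int_mono:
  assumes "embeds A B" "group A" "group B"
  shows "embeds (wreath A integer_group) (wreath B integer_group)"
proof -
  obtain f where f: "f \<in> hom A B" "\<And>x. x \<in> carrier A \<Longrightarrow> f x = \<one>\<^bsub>B\<^esub> \<longleftrightarrow> x = \<one>\<^bsub>A\<^esub>"
    using embedsE[OF assms] by blast
  have fin: "finite {s. f (b s) \<noteq> \<one>\<^bsub>B\<^esub>}" if "finite {s. b s \<noteq> \<one>\<^bsub>A\<^esub>}" "\<forall>s. b s \<in> carrier A" for b :: "int \<Rightarrow> _"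
    using that f(2) by (auto elim!: rev_finite_subset)
  show ?thesis
    by (rule embedsI[where f = "\<lambda>(b, t). (\<lambda>s. f (b s), t)"])
      (use assms f fin in \<open>auto simp: group_wreath hom_def Pi_def carrier_wreath_int mult_wreath_int one_wreath_int fun_eq_iff\<close>)
qed

text \<open>A criterion for embedding a group \<open>H\<close> that splits over \<open>\<int>\<close> with kernel \<open>N\<close>, generated over \<open>N\<close> by
  \<open>x\<close>. Writing elements as \<open>h x\<^sup>k\<close> with \<open>h\<close> in \<open>N\<close>, the map sends \<open>h x\<^sup>k\<close> to the pair of the function
  \<open>i \<mapsto> \<theta> (x\<^sup>i h x\<^sup>-\<^sup>i)\<close> and \<open>k\<close>: multiplication by \<open>x\<close> then becomes the shift of indices in the wreath
  product. The two conditions on \<open>\<theta>\<close> say that this function has finite support and that \<open>h\<close> can be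
  recovered from it.\<close>

lemma embeds_wreath_int:
  fixes H (structure)
  assumes H: "group H" and Q: "group Q" and p: "p \<in> hom H integer_group"
    and x: "x \<in> carrier H" "p x = 1"
    and \<theta>: "\<theta> \<in> hom (H\<lparr>carrier := kernel H integer_group p\<rparr>) Q"
    and fin: "\<And>h. h \<in> kernel H integer_group p \<Longrightarrow>
      finite {i::int. \<theta> (x [^] i \<otimes> h \<otimes> inv (x [^] i)) \<noteq> \<one>\<^bsub>Q\<^esub>}"
    and sep: "\<And>h. h \<in> kernel H integer_group p \<Longrightarrow>
      (\<And>i::int. \<theta> (x [^] i \<otimes> h \<otimes> inv (x [^] i)) = \<one>\<^bsub>Q\<^esub>) \<Longrightarrow> h = \<one>"
  shows "embeds H (wreath Q integer_group)"
proof -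
  interpret H: group H by fact
  interpret p: group_hom H integer_group p
    using p by (simp add: group_hom_def group_hom_axioms_def)
  define N where "N = kernel H integer_group p"
  define c where "c i h = x [^] i \<otimes> h \<otimes> inv (x [^] i)" for i :: int and h
  \<comment> \<open>The factor in \<open>N\<close> of \<open>g\<close>, in the decomposition of \<open>g\<close> as an element of \<open>N\<close> times a power of \<open>x\<close>.\<close>
  define r where "r g = g \<otimes> inv (x [^] p g)" for g
  have p_pow: "p (x [^] i) = i" for i :: int
    using p.hom_int_pow[OF x(1), of i] x by (simp add: mult.commute)
  have \<theta>_mult: "\<theta> (g \<otimes> h) = \<theta> g \<otimes>\<^bsub>Q\<^esub> \<theta> h" if "g \<in> N" "h \<in> N" for g h
    using \<theta> that by (auto simp: hom_def N_def)
  have \<theta>_closed: "\<theta> g \<in> carrier Q" if "g \<in> N" for g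
    using \<theta> that by (auto simp: hom_def N_def)
  have N: "h \<in> N \<longleftrightarrow> h \<in> carrier H \<and> p h = 0" for h
    by (auto simp: N_def kernel_def)
  have c_N: "c i h \<in> N" if "h \<in> N" for i h
    using that x p_pow by (auto simp: c_def N)
  have r_N: "r g \<in> N" if "g \<in> carrier H" for g
    using that x p_pow by (auto simp: r_def N)
  have cancel: "inv y \<otimes> (y \<otimes> z) = z" if "y \<in> carrier H" "z \<in> carrier H" for y z
    using that by (simp flip: H.m_assoc)
  have c_mult: "c i (g \<otimes> h) = c i g \<otimes> c i h" if "g \<in> carrier H" "h \<in> carrier H" for i g h
    using that x by (simp add: c_def H.m_assoc cancel)
  have c_c: "c i (c k h) = c (i + k) h" if "h \<in> carrier H" for i k h
    using that x by (simp add: c_def H.int_pow_mult H.inv_mult_group H.m_assoc)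
  have r_mult: "r (g \<otimes> h) = r g \<otimes> c (p g) (r h)" if "g \<in> carrier H" "h \<in> carrier H" for g h
    using that x by (simp add: r_def c_def H.int_pow_mult H.inv_mult_group H.m_assoc cancel)
  show ?thesis
  proof (rule embedsI[where f = "\<lambda>g. (\<lambda>i. \<theta> (c i (r g)), p g)"])
    show "(\<lambda>g. (\<lambda>i. \<theta> (c i (r g)), p g)) \<in> hom H (wreath Q integer_group)"
    proof (rule homI)
      fix g assume g: "g \<in> carrier H"
      then show "(\<lambda>i. \<theta> (c i (r g)), p g) \<in> carrier (wreath Q integer_group)"
        using fin r_N \<theta>_closed[OF c_N] Q by (auto simp: carrier_wreath_int c_def N_def)
    next
      fix g h assume g: "g \<in> carrier H" "h \<in> carrier H"
      have "\<theta> (c i (r (g \<otimes> h))) = \<theta> (c i (r g)) \<otimes>\<^bsub>Q\<^esub> \<theta> (c (i + p g) (r h))" for i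
      proof -
        have "c i (r (g \<otimes> h)) = c i (r g) \<otimes> c (i + p g) (r h)"
          using r_N[OF g(1)] r_N[OF g(2)] c_N[OF r_N[OF g(2)]] g
          by (simp add: r_mult c_mult c_c N)
        then show ?thesis
          using g c_N r_N \<theta>_mult by simp
      qed
      then show "(\<lambda>i. \<theta> (c i (r (g \<otimes> h))), p (g \<otimes> h)) =
        (\<lambda>i. \<theta> (c i (r g)), p g) \<otimes>\<^bsub>wreath Q integer_group\<^esub> (\<lambda>i. \<theta> (c i (r h)), p h)"
        using g by (simp add: mult_wreath_int)
    qed
  next
    fix g assume g: "g \<in> carrier H"
      and "(\<lambda>i. \<theta> (c i (r g)), p g) = \<one>\<^bsub>wreath Q integer_group\<^esub>"
    then have *: "p g = 0" "\<And>i. \<theta> (c i (r g)) = \<one>\<^bsub>Q\<^esub>"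
      by (auto simp: one_wreath_int fun_eq_iff)
    then have "r g = g"
      using g by (simp add: r_def)
    then show "g = \<one>"
      using sep[of g] * g by (simp add: c_def kernel_def)
  qed (use H Q in \<open>auto simp: group_wreath\<close>)
qed


section \<open>Replacing ambient groups of subgroups of bounded derived length\<close>

lemma (in group_hom) exp_of_derived_img_trivial:
  assumes "K \<subseteq> carrier G" "(derived G ^^ n) K \<subseteq> {\<one>}"
  shows "(derived H ^^ n) (h ` K) \<subseteq> {\<one>\<^bsub>H\<^esub>}"
  using assms exp_of_derived_img[OF assms(1), of n] by auto

lemma (in group) exp_of_derived_consistent:
  assumes "subgroup S G" "K \<subseteq> S"
  shows "(derived (G\<lparr>carrier := S\<rparr>) ^^ n) K = (derived G ^^ n) K"
proof -
  interpret i: group_hom "G\<lparr>carrier := S\<rparr>" G "\<lambda>x. x"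
    using assms subgroup.mem_carrier[OF assms(1)]
    by (auto simp: group_hom_def group_hom_axioms_def hom_def subgroup_imp_group)
  show ?thesis
    using i.exp_of_derived_img[of K n] assms by simp
qed

text \<open>The induction along the tower must speak about all subgroups of a fixed group at once. Triviality of
  the iterated derived subgroup is the condition that \<open>S\<close> has derived length at most \<open>d\<close>, stated in \<open>A\<close>
  so that it can be moved along homomorphisms.\<close>

definition absorbs :: "nat \<Rightarrow> ('a, 'm) monoid_scheme \<Rightarrow> ('b, 'n) monoid_scheme \<Rightarrow> bool"
  where "absorbs d A B \<longleftrightarrow> (\<forall>S. subgroup S A \<and> (derived A ^^ d) S \<subseteq> {\<one>\<^bsub>A\<^esub>} \<longrightarrow>
    embeds (A\<lparr>carrier := S\<rparr>) B)"

text \<open>The form in which \<open>absorbs\<close> is applied: each coordinate homomorphism into \<open>A\<close> can be replaced by one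
  into \<open>B\<close> with the same kernel, so that families with trivial common kernel keep this property.\<close>

lemma absorbs_hom:
  assumes abs: "absorbs d A B" and A: "group A" and B: "group B" and K: "group K"
    and f: "f \<in> hom K A" and dl: "(derived A ^^ d) (f ` carrier K) \<subseteq> {\<one>\<^bsub>A\<^esub>}"
  shows "\<exists>g. g \<in> hom K B \<and> (\<forall>k\<in>carrier K. g k = \<one>\<^bsub>B\<^esub> \<longleftrightarrow> f k = \<one>\<^bsub>A\<^esub>)"
proof -
  interpret f: group_hom K A f
    using A K f by (simp add: group_hom_def group_hom_axioms_def)
  have S: "subgroup (f ` carrier K) A"
    by (rule f.img_is_subgroup)
  with abs dl have "embeds (A\<lparr>carrier := f ` carrier K\<rparr>) B"
    by (simp add: absorbs_def)
  then obtain e where e: "e \<in> hom (A\<lparr>carrier := f ` carrier K\<rparr>) B"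
    "\<And>y. y \<in> carrier (A\<lparr>carrier := f ` carrier K\<rparr>) \<Longrightarrow>
      e y = \<one>\<^bsub>B\<^esub> \<longleftrightarrow> y = \<one>\<^bsub>A\<lparr>carrier := f ` carrier K\<rparr>\<^esub>"
    by (rule embedsE[OF _ f.H.subgroup_imp_group[OF S] B]) blast
  have "f \<in> hom K (A\<lparr>carrier := f ` carrier K\<rparr>)"
    using f by (auto simp: hom_def)
  from hom_compose[OF this e(1)] have "e \<circ> f \<in> hom K B" .
  moreover have "(e \<circ> f) k = \<one>\<^bsub>B\<^esub> \<longleftrightarrow> f k = \<one>\<^bsub>A\<^esub>" if "k \<in> carrier K" for k
    using e(2)[of "f k"] that by simp
  ultimately show ?thesis by blast
qed

lemma absorbs_embeds_left:
  assumes emb: "embeds A A'" and abs: "absorbs d A' B" and "group A" "group A'" "group B"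
  shows "absorbs d A B"
  unfolding absorbs_def
proof safe
  fix S assume S: "subgroup S A" "(derived A ^^ d) S \<subseteq> {\<one>\<^bsub>A\<^esub>}"
  obtain f where f: "f \<in> hom A A'" "\<And>x. x \<in> carrier A \<Longrightarrow> f x = \<one>\<^bsub>A'\<^esub> \<longleftrightarrow> x = \<one>\<^bsub>A\<^esub>"
    using embedsE[OF emb] assms by metis
  interpret f: group_hom A A' f
    using assms f by (simp add: group_hom_def group_hom_axioms_def)
  let ?K = "A\<lparr>carrier := S\<rparr>"
  have SA: "S \<subseteq> carrier A"
    using S(1) by (rule subgroup.subset)
  have "f \<in> hom ?K A'"
    by (rule hom_from_subset[OF f(1) SA])
  moreover have "(derived A' ^^ d) (f ` S) \<subseteq> {\<one>\<^bsub>A'\<^esub>}"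
    by (rule f.exp_of_derived_img_trivial[OF SA S(2)])
  ultimately obtain g where "g \<in> hom ?K B" "\<And>k. k \<in> S \<Longrightarrow> g k = \<one>\<^bsub>B\<^esub> \<longleftrightarrow> f k = \<one>\<^bsub>A'\<^esub>"
    using absorbs_hom[OF abs _ _ f.G.subgroup_imp_group[OF S(1)], of f] assms by auto
  then show "embeds ?K B"
    using f(2) SA assms by (intro embedsI[OF f.G.subgroup_imp_group[OF S(1)]]) auto
qed

lemma absorbs_embeds_right: "absorbs d A B \<Longrightarrow> embeds B B' \<Longrightarrow> absorbs d A B'"
  by (auto simp: absorbs_def intro: embeds_trans)

lemma absorbs_sum_group:
  assumes abs: "absorbs d A B" and A: "group A" and B: "group B"
  shows "absorbs d (sum_group I (\<lambda>_. A)) (sum_group I (\<lambda>_. B))"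
  unfolding absorbs_def
proof safe
  let ?A = "sum_group I (\<lambda>_. A)"
  fix S assume S: "subgroup S ?A" "(derived ?A ^^ d) S \<subseteq> {\<one>\<^bsub>?A\<^esub>}"
  let ?K = "?A\<lparr>carrier := S\<rparr>"
  have SA: "S \<subseteq> carrier ?A"
    using S(1) by (rule subgroup.subset)
  have K: "group ?K"
    using A S(1) by (simp add: group.subgroup_imp_group)
  have "\<exists>g. g \<in> hom ?K B \<and> (\<forall>k\<in>S. g k = \<one>\<^bsub>B\<^esub> \<longleftrightarrow> k i = \<one>\<^bsub>A\<^esub>)" if "i \<in> I" for i
  proof -
    have hom: "(\<lambda>b. b i) \<in> hom ?A A"
      using A that by (intro proj_hom_sum_group) auto
    then interpret f: group_hom ?A A "\<lambda>b. b i"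
      using A by (simp add: group_hom_def group_hom_axioms_def)
    have "(\<lambda>b. b i) \<in> hom ?K A"
      by (rule hom_from_subset[OF hom SA])
    moreover have "(derived A ^^ d) ((\<lambda>b. b i) ` carrier ?K) \<subseteq> {\<one>\<^bsub>A\<^esub>}"
      using f.exp_of_derived_img_trivial[OF SA S(2)] by simp
    ultimately show ?thesis
      using absorbs_hom[OF abs A B K] by fastforce
  qed
  then obtain g where g: "\<And>i. i \<in> I \<Longrightarrow> g i \<in> hom ?K B"
    "\<And>i k. i \<in> I \<Longrightarrow> k \<in> S \<Longrightarrow> g i k = \<one>\<^bsub>B\<^esub> \<longleftrightarrow> k i = \<one>\<^bsub>A\<^esub>"
    by metis
  show "embeds ?K (sum_group I (\<lambda>_. B))"
  proof (rule embeds_sum_group[where f = g])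
    fix k assume k: "k \<in> carrier ?K"
    then have "{i \<in> I. g i k \<noteq> \<one>\<^bsub>B\<^esub>} = {i \<in> I. k i \<noteq> \<one>\<^bsub>A\<^esub>}"
      using g(2) by auto
    then show "finite {i \<in> I. g i k \<noteq> \<one>\<^bsub>B\<^esub>}"
      using finite_support_sum_group[of I "\<lambda>_. A" k] A SA k by auto
    assume *: "\<And>i. i \<in> I \<Longrightarrow> g i k = \<one>\<^bsub>B\<^esub>"
    have "k = \<one>\<^bsub>?A\<^esub>"
      by (rule sum_group_eq_oneI) (use A SA k g(2) * in auto)
    then show "k = \<one>\<^bsub>?K\<^esub>" by simp
  qed (use K B g in auto)
qed

text \<open>Euclid's argument that a subgroup of \<open>\<int>\<close> is generated by its least positive element, for the set of
  values of \<open>p\<close> on \<open>S\<close>; it returns a preimage of that generator.\<close>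

lemma least_positive_divisor_of_values:
  fixes p :: "'a \<Rightarrow> int"
  assumes "g \<in> S" "p g \<noteq> 0"
    and diff: "\<And>a b k. a \<in> S \<Longrightarrow> b \<in> S \<Longrightarrow> \<exists>c\<in>S. p c = p a - k * p b"
  obtains x where "x \<in> S" "p x > 0" "\<And>a. a \<in> S \<Longrightarrow> p x dvd p a"
proof -
  have "\<exists>x\<in>S. p x > 0"
  proof (cases "p g > 0")
    case False
    obtain c where "c \<in> S" "p c = p g - 2 * p g"
      using diff[OF assms(1,1)] by blast
    then show ?thesis using False assms(2) by (intro bexI[of _ c]) auto
  qed (use assms(1) in auto)
  then have "\<exists>x. x \<in> S \<and> p x > 0" by auto
  then obtain x where x: "x \<in> S" "p x > 0"
    and least: "\<And>y. y \<in> S \<Longrightarrow> p y > 0 \<Longrightarrow> nat (p x) \<le> nat (p y)"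
    using ex_has_least_nat[of "\<lambda>x. x \<in> S \<and> p x > 0" _ "\<lambda>x. nat (p x)"] by metis
  show ?thesis
  proof (rule that[OF x])
    fix a assume "a \<in> S"
    then obtain c where c: "c \<in> S" "p c = p a - (p a div p x) * p x"
      using diff x by blast
    then have pc: "p c = p a mod p x"
      by (simp add: minus_div_mult_eq_mod)
    then have "\<not> p c > 0"
      using least[OF c(1)] x(2) pos_mod_bound[OF x(2), of "p a"] by linarith
    then have "p a mod p x = 0"
      using pc pos_mod_sign[OF x(2), of "p a"] by linarith
    then show "p x dvd p a" by (simp add: dvd_eq_mod_eq_0)
  qed
qed

text \<open>The two alternatives correspond to \<open>S\<close> lying in the base group or not. In the second case the
  hypothesis about \<open>B\<close> concerns derived length \<open>d\<close> only, although \<open>S\<close> may have derived length \<open>d + 1\<close>: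
  the base part \<open>N\<close> of \<open>S\<close> and the derived subgroup of \<open>S\<close> have the same projection to every
  coordinate (\<open>proj_D\<close> and \<open>D\<close> in the proof).\<close>

lemma wreath_int_subgroup_embeds:
  fixes A :: "('a, 'm) monoid_scheme" and B :: "('b, 'n) monoid_scheme" and C :: "('c, 'k) monoid_scheme"
  assumes A: "group A" and B: "group B" and C: "group C"
    and absB: "absorbs d A B" and absC: "absorbs (Suc d) A C"
    and S: "subgroup S (wreath A integer_group)"
    and dl: "(derived (wreath A integer_group) ^^ Suc d) S \<subseteq> {\<one>\<^bsub>wreath A integer_group\<^esub>}"
  shows "embeds ((wreath A integer_group)\<lparr>carrier := S\<rparr>) (sum_group UNIV (\<lambda>_::int. C)) \<or>
    embeds ((wreath A integer_group)\<lparr>carrier := S\<rparr>) (wreath (sum_group UNIV (\<lambda>_::int. B)) integer_group)"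
proof -
  define W where "W = wreath A integer_group"
  define K where "K = W\<lparr>carrier := S\<rparr>"
  define N where "N = S \<inter> wreath_base A"
  define KN where "KN = W\<lparr>carrier := N\<rparr>"
  interpret A: group A by fact
  interpret W: group W
    using A by (simp add: W_def group_wreath)
  note S = S[folded W_def] and dl = dl[folded W_def]
  interpret snd: group_hom W integer_group snd
    using snd_hom_wreath_int W.group_axioms by (simp add: group_hom_def group_hom_axioms_def W_def)
  have K: "group K"
    unfolding K_def by (rule W.subgroup_imp_group[OF S])
  have SW: "S \<subseteq> carrier W"
    using S by (rule subgroup.subset)
  have N: "subgroup N W"
    unfolding N_def
    by (rule W.subgroups_Inter_pair[OF S subgroup_wreath_base[OF A, folded W_def]])
  have KN: "group KN"
    unfolding KN_def by (rule W.subgroup_imp_group[OF N])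
  have NW: "N \<subseteq> carrier W" and NS: "N \<subseteq> S"
    using SW by (auto simp: N_def)
  have N_iff: "g \<in> N \<longleftrightarrow> g \<in> S \<and> snd g = 0" for g
    using SW by (auto simp: N_def wreath_base_def W_def)
  have mult: "fst (x \<otimes>\<^bsub>W\<^esub> y) s = fst x s \<otimes>\<^bsub>A\<^esub> fst y (s + snd x)" for x y s
    by (simp add: W_def fst_mult_wreath_int)
  have coord_closed: "fst x s \<in> carrier A" if "x \<in> carrier W" for x s
    using that A by (simp add: W_def fst_wreath_int_closed)
  have supp: "finite {s. fst x s \<noteq> \<one>\<^bsub>A\<^esub>}" if "x \<in> carrier W" for x
    using that A by (auto simp: W_def carrier_wreath_int)
  have one_coord: "fst \<one>\<^bsub>W\<^esub> s = \<one>\<^bsub>A\<^esub>" for s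
    by (simp add: W_def one_wreath_int)
  have eq_one: "x = \<one>\<^bsub>W\<^esub>" if "x \<in> N" "\<And>s. fst x s = \<one>\<^bsub>A\<^esub>" for x
    using that wreath_base_eq_oneI[of x A] by (simp add: N_def W_def)
  have coord: "(\<lambda>x. fst x s) \<in> hom KN A" for s
    unfolding KN_def W_def by (rule coord_hom_wreath_base[OF A]) (simp add: N_def)
  have coord_KN: "group_hom KN A (\<lambda>x. fst x s)" for s
    using coord KN A by (simp add: group_hom_def group_hom_axioms_def)
  show ?thesis
  proof (cases "N = S")
    case True
    have "\<exists>g. g \<in> hom KN C \<and> (\<forall>k\<in>N. g k = \<one>\<^bsub>C\<^esub> \<longleftrightarrow> fst k s = \<one>\<^bsub>A\<^esub>)" for s
    proof -
      interpret group_hom KN A "\<lambda>x. fst x s" by (rule coord_KN)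
      have "(derived KN ^^ Suc d) N \<subseteq> {\<one>\<^bsub>KN\<^esub>}"
        using dl W.exp_of_derived_consistent[OF N order.refl, of "Suc d"] True
        by (simp add: KN_def)
      then have "(derived A ^^ Suc d) ((\<lambda>x. fst x s) ` carrier KN) \<subseteq> {\<one>\<^bsub>A\<^esub>}"
        by (intro exp_of_derived_img_trivial) (auto simp: KN_def)
      from absorbs_hom[OF absC A C KN coord this] show ?thesis
        by (simp add: KN_def)
    qed
    then obtain g where g: "\<And>s. g s \<in> hom KN C"
      "\<And>s k. k \<in> N \<Longrightarrow> g s k = \<one>\<^bsub>C\<^esub> \<longleftrightarrow> fst k s = \<one>\<^bsub>A\<^esub>"
      by metis
    have "embeds KN (sum_group UNIV (\<lambda>_::int. C))"
    proof (rule embeds_sum_group[where f = g])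
      fix k assume k: "k \<in> carrier KN"
      then show "finite {s \<in> UNIV. g s k \<noteq> \<one>\<^bsub>C\<^esub>}"
        using g(2)[of k] supp[of k] NW by (auto simp: KN_def)
      assume "\<And>s. s \<in> UNIV \<Longrightarrow> g s k = \<one>\<^bsub>C\<^esub>"
      then show "k = \<one>\<^bsub>KN\<^esub>"
        using g(2)[of k] k eq_one[of k] by (auto simp: KN_def N_iff)
    qed (use KN C g in auto)
    then show ?thesis
      using True by (simp add: KN_def W_def)
  next
    case False
    then obtain g0 where g0: "g0 \<in> S" "snd g0 \<noteq> 0"
      using NS N_iff by blast
    have snd_mult: "snd (x \<otimes>\<^bsub>W\<^esub> y) = snd x + snd y" for x y
      by (simp add: W_def snd_mult_wreath_int)
    have pow_S: "x [^]\<^bsub>W\<^esub> (k::int) \<in> S" if "x \<in> S" for x k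
      using W.subgroup_int_pow_closed[OF S that] .
    have snd_pow: "snd (x [^]\<^bsub>W\<^esub> (k::int)) = k * snd x" if "x \<in> S" for x k
      using snd.hom_int_pow[of x k] that SW by auto
    obtain x where x: "x \<in> S" "snd x > 0" "\<And>g. g \<in> S \<Longrightarrow> snd x dvd snd g"
    proof (rule least_positive_divisor_of_values[of g0 S snd])
      fix a b and k :: int assume "a \<in> S" "b \<in> S"
      then show "\<exists>c\<in>S. snd c = snd a - k * snd b"
        using pow_S[of b "- k"] snd_pow[of b "- k"] subgroup.m_closed[OF S]
        by (intro bexI[of _ "a \<otimes>\<^bsub>W\<^esub> b [^]\<^bsub>W\<^esub> (- k)"]) (auto simp: snd_mult)
    qed (use g0 in blast)+
    \<comment> \<open>Conjugation by \<open>x\<close> shifts by \<open>m\<close>; as all shifts in \<open>S\<close> are multiples of \<open>m\<close>, \<open>S\<close> is generated by \<open>N\<close> and \<open>x\<close>.\<close>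
    define m where "m = snd x"
    have m: "m > 0" using x by (simp add: m_def)
    define c where "c i h = x [^]\<^bsub>W\<^esub> i \<otimes>\<^bsub>W\<^esub> h \<otimes>\<^bsub>W\<^esub> inv\<^bsub>W\<^esub> (x [^]\<^bsub>W\<^esub> i)" for i :: int and h
    have c: "snd (c i h) = 0" "fst (c i h) s = \<one>\<^bsub>A\<^esub> \<longleftrightarrow> fst h (s + i * m) = \<one>\<^bsub>A\<^esub>"
      if "h \<in> N" for i h s
      using conj_wreath_int[OF A, where y = "x [^]\<^bsub>W\<^esub> i" and h = h and z = "c i h"] that NW SW pow_S[OF x(1), of i]
        snd_pow[OF x(1), of i]
      by (auto simp: W_def c_def m_def N_iff)
    have c_N: "c i h \<in> N" if "h \<in> N" for i h
      using that NS pow_S[OF x(1), of i] c(1)[OF that] S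
      by (auto simp: N_iff c_def intro!: subgroup.m_closed subgroup.m_inv_closed)
    have shift_fin: "finite {i. fst h (j + i * m) \<noteq> \<one>\<^bsub>A\<^esub>}" if "h \<in> N" for h j
    proof (rule finite_subset)
      show "finite ((\<lambda>s. (s - j) div m) ` {s. fst h s \<noteq> \<one>\<^bsub>A\<^esub>})"
        by (intro finite_imageI supp) (use that NW in blast)
      show "{i. fst h (j + i * m) \<noteq> \<one>\<^bsub>A\<^esub>} \<subseteq> (\<lambda>s. (s - j) div m) ` {s. fst h s \<noteq> \<one>\<^bsub>A\<^esub>}"
      proof
        fix i assume "i \<in> {i. fst h (j + i * m) \<noteq> \<one>\<^bsub>A\<^esub>}"
        then show "i \<in> (\<lambda>s. (s - j) div m) ` {s. fst h s \<noteq> \<one>\<^bsub>A\<^esub>}"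
          using m by (intro image_eqI[of _ _ "j + i * m"]) auto
      qed
    qed
    have D: "derived W S \<subseteq> N"
      using W.derived_incl[OF order.refl S] derived_subset_wreath_base[OF A, of S] SW
      by (simp add: N_def W_def)
    \<comment> \<open>For a power \<open>y\<close> of \<open>x\<close> that moves the support of \<open>h\<close> off \<open>j\<close>, the conjugate of \<open>h\<^sup>-\<^sup>1\<close> by \<open>y\<close> is trivial
      at \<open>j\<close>, so the commutator \<open>h (y h\<^sup>-\<^sup>1 y\<^sup>-\<^sup>1)\<close> has the same entry at \<open>j\<close> as \<open>h\<close>.\<close>
    have proj_D: "fst h j \<in> (\<lambda>x. fst x j) ` derived W S" if h: "h \<in> N" for h j
    proof -
      obtain i where i: "fst h (j + i * m) = \<one>\<^bsub>A\<^esub>"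
        using ex_new_if_finite[OF infinite_UNIV_int shift_fin[OF h, of j]] by auto
      define y where "y = x [^]\<^bsub>W\<^esub> i"
      have y: "y \<in> S" "y \<in> carrier W"
        using pow_S[OF x(1)] SW by (auto simp: y_def)
      have hW: "h \<in> carrier W" "h \<in> S" using h NW NS by auto
      have h': "inv\<^bsub>W\<^esub> h \<in> N"
        using subgroup.m_inv_closed[OF N h] .
      have "\<one>\<^bsub>A\<^esub> = fst (h \<otimes>\<^bsub>W\<^esub> inv\<^bsub>W\<^esub> h) (j + i * m)"
        using hW(1) W.r_inv by (simp add: W.r_inv one_coord)
      also have "\<dots> = fst (inv\<^bsub>W\<^esub> h) (j + i * m)"
        using i h coord_closed[of "inv\<^bsub>W\<^esub> h"] W.inv_closed[OF hW(1)] by (simp add: mult N_iff)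
      finally have "fst (c i (inv\<^bsub>W\<^esub> h)) j = \<one>\<^bsub>A\<^esub>"
        using c(2)[OF h'] by simp
      then have "fst (h \<otimes>\<^bsub>W\<^esub> c i (inv\<^bsub>W\<^esub> h)) j = fst h j"
        using h coord_closed[OF hW(1)] by (simp add: mult N_iff)
      moreover have "h \<otimes>\<^bsub>W\<^esub> c i (inv\<^bsub>W\<^esub> h) = h \<otimes>\<^bsub>W\<^esub> y \<otimes>\<^bsub>W\<^esub> inv\<^bsub>W\<^esub> h \<otimes>\<^bsub>W\<^esub> inv\<^bsub>W\<^esub> y"
        using hW y by (simp add: c_def y_def[symmetric] W.m_assoc)
      moreover have "h \<otimes>\<^bsub>W\<^esub> y \<otimes>\<^bsub>W\<^esub> inv\<^bsub>W\<^esub> h \<otimes>\<^bsub>W\<^esub> inv\<^bsub>W\<^esub> y \<in> derived W S"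
        unfolding derived_def using hW(2) y(1) by (intro generate.incl) blast
      ultimately show ?thesis by (metis image_eqI)
    qed
    have "\<exists>g. g \<in> hom KN B \<and> (\<forall>k\<in>N. g k = \<one>\<^bsub>B\<^esub> \<longleftrightarrow> fst k s = \<one>\<^bsub>A\<^esub>)" for s
    proof -
      interpret group_hom KN A "\<lambda>x. fst x s" by (rule coord_KN)
      have "(derived KN ^^ d) (derived W S) \<subseteq> {\<one>\<^bsub>KN\<^esub>}"
        using dl W.exp_of_derived_consistent[OF N D, of d]
        by (simp add: KN_def funpow_swap1)
      then have "(derived A ^^ d) ((\<lambda>x. fst x s) ` derived W S) \<subseteq> {\<one>\<^bsub>A\<^esub>}"
        using D by (intro exp_of_derived_img_trivial) (auto simp: KN_def)
      moreover have "(\<lambda>x. fst x s) ` carrier KN \<subseteq> (\<lambda>x. fst x s) ` derived W S"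
        using proj_D by (auto simp: KN_def)
      ultimately have "(derived A ^^ d) ((\<lambda>x. fst x s) ` carrier KN) \<subseteq> {\<one>\<^bsub>A\<^esub>}"
        using A.mono_exp_of_derived by blast
      from absorbs_hom[OF absB A B KN coord this] show ?thesis
        by (simp add: KN_def)
    qed
    then obtain g where g: "\<And>s. g s \<in> hom KN B"
      "\<And>s k. k \<in> N \<Longrightarrow> g s k = \<one>\<^bsub>B\<^esub> \<longleftrightarrow> fst k s = \<one>\<^bsub>A\<^esub>"
      by metis
    \<comment> \<open>The window of coordinates from 0 to \<open>m - 1\<close>: its translates by multiples of \<open>m\<close> cover every
      coordinate exactly once, so the conjugates by powers of \<open>x\<close>, seen through the window, determine \<open>h\<close>.\<close>
    define Q where "Q = sum_group {0..<m} (\<lambda>_. B)"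
    define \<theta> where "\<theta> k = (\<lambda>s\<in>{0..<m}. g s k)" for k
    have Q: "group Q" using B by (simp add: Q_def)
    have \<theta>_one: "\<theta> k = \<one>\<^bsub>Q\<^esub> \<longleftrightarrow> (\<forall>s\<in>{0..<m}. fst k s = \<one>\<^bsub>A\<^esub>)" if "k \<in> N" for k
    proof -
      have "\<theta> k = \<one>\<^bsub>Q\<^esub> \<longleftrightarrow> (\<forall>s\<in>{0..<m}. g s k = \<one>\<^bsub>B\<^esub>)"
        unfolding \<theta>_def Q_def by (rule restrict_eq_one_sum_group)
      then show ?thesis
        using g(2)[OF that] by simp
    qed
    define p where "p k = snd k div m" for k :: "(int \<Rightarrow> 'a) \<times> int"
    have ker: "kernel K integer_group p = N"
      using m x(3) by (auto simp: kernel_def p_def K_def N_iff m_def dvd_div_eq_0_iff)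
    have inv_K: "inv\<^bsub>K\<^esub> y = inv\<^bsub>W\<^esub> y" if "y \<in> S" for y
      using W.m_inv_consistent[OF S that] by (simp add: K_def)
    have pow_K: "x [^]\<^bsub>K\<^esub> i = x [^]\<^bsub>W\<^esub> i" for i :: int
      using W.int_pow_consistent[OF S x(1)] by (simp add: K_def)
    have conj_K: "x [^]\<^bsub>K\<^esub> i \<otimes>\<^bsub>K\<^esub> h \<otimes>\<^bsub>K\<^esub> inv\<^bsub>K\<^esub> (x [^]\<^bsub>K\<^esub> i) = c i h" for i :: int and h
      using pow_S[OF x(1)] by (simp add: pow_K inv_K c_def) (simp add: K_def)
    have "embeds K (wreath Q integer_group)"
    proof (rule embeds_wreath_int[where p = p and x = x and \<theta> = \<theta>])
      show "p \<in> hom K integer_group"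
        using x(3) by (auto simp: hom_def K_def p_def snd_mult m_def div_add)
      show "x \<in> carrier K" "p x = 1"
        using x m by (auto simp: K_def p_def m_def)
      have "\<theta> \<in> hom KN Q"
        unfolding Q_def \<theta>_def[abs_def]
        by (rule hom_into_sum_group) (use B g(1) in \<open>auto intro: finite_subset[of _ "{0..<m}"]\<close>)
      then show "\<theta> \<in> hom (K\<lparr>carrier := kernel K integer_group p\<rparr>) Q"
        unfolding ker by (simp add: KN_def K_def)
    next
      fix h assume "h \<in> kernel K integer_group p"
      then have h: "h \<in> N" by (simp add: ker)
      have \<theta>_c: "\<theta> (c i h) = \<one>\<^bsub>Q\<^esub> \<longleftrightarrow> (\<forall>s\<in>{0..<m}. fst h (s + i * m) = \<one>\<^bsub>A\<^esub>)" for i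
        using \<theta>_one[OF c_N[OF h]] c(2)[OF h] by simp
      have "{i. \<theta> (c i h) \<noteq> \<one>\<^bsub>Q\<^esub>} = (\<Union>s\<in>{0..<m}. {i. fst h (s + i * m) \<noteq> \<one>\<^bsub>A\<^esub>})"
        by (auto simp: \<theta>_c)
      then show "finite {i::int. \<theta> (x [^]\<^bsub>K\<^esub> i \<otimes>\<^bsub>K\<^esub> h \<otimes>\<^bsub>K\<^esub> inv\<^bsub>K\<^esub> (x [^]\<^bsub>K\<^esub> i)) \<noteq> \<one>\<^bsub>Q\<^esub>}"
        using shift_fin[OF h] by (simp add: conj_K)
      assume "\<And>i. \<theta> (x [^]\<^bsub>K\<^esub> (i::int) \<otimes>\<^bsub>K\<^esub> h \<otimes>\<^bsub>K\<^esub> inv\<^bsub>K\<^esub> (x [^]\<^bsub>K\<^esub> i)) = \<one>\<^bsub>Q\<^esub>"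
      then have *: "fst h (s + i * m) = \<one>\<^bsub>A\<^esub>" if "s \<in> {0..<m}" for s i
        using that \<theta>_c by (simp add: conj_K)
      have "fst h s = \<one>\<^bsub>A\<^esub>" for s
        using *[of "s mod m" "s div m"] m by simp
      then have "h = \<one>\<^bsub>W\<^esub>"
        using h by (intro eq_one) auto
      then show "h = \<one>\<^bsub>K\<^esub>" by (simp add: K_def)
    qed (use K Q in auto)
    moreover have "embeds (wreath Q integer_group) (wreath (sum_group UNIV (\<lambda>_::int. B)) integer_group)"
      unfolding Q_def using B
      by (intro wreath_int_mono sum_group_embeds_reindex[where e = "\<lambda>i. i"] embeds_refl) auto
    ultimately show ?thesis
      using embeds_trans by (auto simp: K_def W_def)
  qed
qed


section \<open>Derived lengths of sums and wreath products\<close>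

text \<open>The infimum defining the derived length is attained if it is finite, and the derived series is
  decreasing.\<close>

lemma (in group) derived_length_le_iff:
  "derived_length G \<le> enat d \<longleftrightarrow> (derived G ^^ d) (carrier G) \<subseteq> {\<one>}"
proof
  assume "(derived G ^^ d) (carrier G) \<subseteq> {\<one>}"
  then have "(derived G ^^ d) (carrier G) = {\<one>}"
    using subgroup.one_closed[OF exp_of_derived_is_subgroup[OF subgroup_self, of d]] by auto
  then show "derived_length G \<le> enat d"
    unfolding derived_length_def by (auto intro: Inf_lower)
next
  let ?L = "{enat n | n. (derived G ^^ n) (carrier G) = {\<one>}}"
  assume le: "derived_length G \<le> enat d"
  have "\<exists>x\<in>?L. x \<le> enat d"
  proof (rule ccontr)
    assume "\<not> (\<exists>x\<in>?L. x \<le> enat d)"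
    then have "\<forall>x\<in>?L. enat (Suc d) \<le> x"
      unfolding Suc_ile_eq not_le[symmetric] by blast
    then have "enat (Suc d) \<le> derived_length G"
      unfolding derived_length_def by (intro Inf_greatest) blast
    then have "enat (Suc d) \<le> enat d"
      using le by (rule order.trans)
    then show False by simp
  qed
  then obtain n where n: "n \<le> d" "(derived G ^^ n) (carrier G) = {\<one>}" by auto
  have "(derived G ^^ d) (carrier G) \<subseteq> (derived G ^^ n) (carrier G)"
  proof (rule lift_Suc_antimono_le[OF _ n(1)])
    fix k show "(derived G ^^ Suc k) (carrier G) \<subseteq> (derived G ^^ k) (carrier G)"
      using derived_incl[OF order.refl exp_of_derived_is_subgroup[OF subgroup_self, of k]] by simp
  qed
  with n show "(derived G ^^ d) (carrier G) \<subseteq> {\<one>}" by simp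
qed

text \<open>A group with jointly injective homomorphisms to groups of derived length at most \<open>n\<close> is a subgroup of
  their product. Direct sums, base groups of wreath products and embeddings are all of this kind.\<close>

lemma exp_of_derived_trivial_family:
  assumes G: "group G" and H: "\<And>j. j \<in> J \<Longrightarrow> group (F j)" and f: "\<And>j. j \<in> J \<Longrightarrow> f j \<in> hom G (F j)"
    and K: "K \<subseteq> carrier G"
    and dl: "\<And>j. j \<in> J \<Longrightarrow> (derived (F j) ^^ n) (carrier (F j)) \<subseteq> {\<one>\<^bsub>F j\<^esub>}"
    and sep: "\<And>g. g \<in> carrier G \<Longrightarrow> (\<And>j. j \<in> J \<Longrightarrow> f j g = \<one>\<^bsub>F j\<^esub>) \<Longrightarrow> g = \<one>\<^bsub>G\<^esub>"
  shows "(derived G ^^ n) K \<subseteq> {\<one>\<^bsub>G\<^esub>}"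
proof
  fix g assume g: "g \<in> (derived G ^^ n) K"
  have "f j g = \<one>\<^bsub>F j\<^esub>" if j: "j \<in> J" for j
  proof -
    interpret group_hom G "F j" "f j"
      using G H[OF j] f[OF j] by (simp add: group_hom_def group_hom_axioms_def)
    have "f j g \<in> (derived (F j) ^^ n) (f j ` K)"
      using g exp_of_derived_img[OF K, of n] by auto
    also have "\<dots> \<subseteq> (derived (F j) ^^ n) (carrier (F j))"
      using K by (intro H.mono_exp_of_derived) auto
    finally show ?thesis using dl[OF j] by auto
  qed
  then show "g \<in> {\<one>\<^bsub>G\<^esub>}"
    using sep[of g] g group.exp_of_derived_in_carrier[OF G K, of n] by auto
qed

lemma derived_length_embeds_le:
  assumes "embeds G H" "group G" "group H" "derived_length H \<le> enat d"
  shows "derived_length G \<le> enat d"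
proof -
  obtain f where f: "f \<in> hom G H" "\<And>x. x \<in> carrier G \<Longrightarrow> f x = \<one>\<^bsub>H\<^esub> \<longleftrightarrow> x = \<one>\<^bsub>G\<^esub>"
    using embedsE[OF assms(1-3)] by metis
  show ?thesis
    using exp_of_derived_trivial_family[of G "{()}" "\<lambda>_. H" "\<lambda>_. f" "carrier G" d] assms f
    by (simp add: group.derived_length_le_iff)
qed

lemma derived_length_sum_group_le:
  assumes "\<And>i. i \<in> I \<Longrightarrow> group (F i)" "\<And>i. i \<in> I \<Longrightarrow> derived_length (F i) \<le> enat d"
  shows "derived_length (sum_group I F) \<le> enat d"
proof -
  have "(derived (sum_group I F) ^^ d) (carrier (sum_group I F)) \<subseteq> {\<one>\<^bsub>sum_group I F\<^esub>}"
  proof (rule exp_of_derived_trivial_family[where f = "\<lambda>i b. b i"])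
    show "(\<lambda>b. b i) \<in> hom (sum_group I F) (F i)" if "i \<in> I" for i
      using proj_hom_sum_group[of I F i] assms(1) that by simp
    show "g = \<one>\<^bsub>sum_group I F\<^esub>"
      if "g \<in> carrier (sum_group I F)" "\<And>i. i \<in> I \<Longrightarrow> g i = \<one>\<^bsub>F i\<^esub>" for g
      using sum_group_eq_oneI[of I F g] assms(1) that by simp
  qed (use assms in \<open>auto simp: group.derived_length_le_iff\<close>)
  then show ?thesis
    using assms(1) by (simp add: group.derived_length_le_iff)
qed

lemma derived_length_wreath_int_le:
  assumes A: "group A" and dl: "derived_length A \<le> enat d"
  shows "derived_length (wreath A integer_group) \<le> enat (Suc d)"
proof -
  define W where "W = wreath A integer_group"
  define KN where "KN = W\<lparr>carrier := wreath_base A\<rparr>"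
  interpret W: group W
    using A by (simp add: W_def group_wreath)
  have N: "subgroup (wreath_base A) W"
    using A by (simp add: W_def subgroup_wreath_base)
  have D: "derived W (carrier W) \<subseteq> wreath_base A"
    unfolding W_def by (rule derived_subset_wreath_base[OF A order.refl])
  have "(derived KN ^^ d) (derived W (carrier W)) \<subseteq> {\<one>\<^bsub>KN\<^esub>}"
  proof (rule exp_of_derived_trivial_family[where f = "\<lambda>s x. fst x s" and J = UNIV and F = "\<lambda>_. A"])
    show "group KN"
      unfolding KN_def by (rule W.subgroup_imp_group[OF N])
    show "(\<lambda>x. fst x s) \<in> hom KN A" for s
      using coord_hom_wreath_base[OF A order.refl] by (simp add: KN_def W_def)
    show "g = \<one>\<^bsub>KN\<^esub>" if "g \<in> carrier KN" "\<And>s. s \<in> UNIV \<Longrightarrow> fst g s = \<one>\<^bsub>A\<^esub>" for g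
      using wreath_base_eq_oneI[of g A] that by (simp add: KN_def W_def)
  qed (use A D dl in \<open>auto simp: KN_def group.derived_length_le_iff\<close>)
  then have "(derived W ^^ Suc d) (carrier W) \<subseteq> {\<one>\<^bsub>W\<^esub>}"
    using W.exp_of_derived_consistent[OF N D, of d] by (simp add: KN_def funpow_swap1)
  then show ?thesis
    using W.derived_length_le_iff by (simp add: W_def)
qed


section \<open>The tower of groups\<close>

lemma tower_group_Suc_iso:
  "sum_group UNIV (\<lambda>_::int. wreath (tower_group n) integer_group) \<cong> tower_group (Suc n)"
  by (auto simp: is_iso_def image_group_def iso_def hom_def bij_betw_def inj_on_def
      intro!: exI[of _ Node])

lemma carrier_tower_group_0: "carrier (tower_group 0) = {\<one>\<^bsub>tower_group 0\<^esub>}"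
  by (simp add: singleton_group_def)

lemma group_tower_step: "group (sum_group UNIV (\<lambda>_::int. wreath (tower_group n) integer_group))"
  by (simp add: group_wreath group_tower_group)

lemma tower_group_Suc_embeds:
  "embeds (tower_group (Suc n)) (sum_group UNIV (\<lambda>_::int. wreath (tower_group n) integer_group))"
  using group.iso_sym[OF group_tower_step tower_group_Suc_iso] by (rule iso_imp_embeds)

lemma wreath_tower_group_embeds: "embeds (wreath (tower_group n) integer_group) (tower_group (Suc n))"
  using embeds_trans[OF embeds_into_sum_group[of _ "0::int" UNIV] iso_imp_embeds[OF tower_group_Suc_iso]]
  by (simp add: group_wreath group_tower_group)

lemma trivial_embeds:
  assumes "group G" "group H" "carrier G \<subseteq> {\<one>\<^bsub>G\<^esub>}"
  shows "embeds G H"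
  using assms by (intro embedsI[OF _ _ const_one_hom]) auto

text \<open>\<open>G\<^sub>n\<close> is itself a direct sum over \<open>\<int>\<close> of copies of one group, and a countable sum of such sums is again
  one.\<close>

lemma sum_tower_group_embeds: "embeds (sum_group UNIV (\<lambda>_::int. tower_group n)) (tower_group n)"
proof (cases n)
  case 0
  have "b = \<one>\<^bsub>sum_group UNIV (\<lambda>_::int. tower_group 0)\<^esub>"
    if "b \<in> carrier (sum_group UNIV (\<lambda>_::int. tower_group 0))" for b
  proof (rule sum_group_eq_oneI[OF group_tower_group that])
    fix i :: int
    have "b i \<in> carrier (tower_group 0)"
      using that by (simp add: carrier_sum_group group_tower_group PiE_iff del: tower_group.simps)
    then show "b i = \<one>\<^bsub>tower_group 0\<^esub>"
      by (simp only: carrier_tower_group_0 singleton_iff)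
  qed
  then have "carrier (sum_group UNIV (\<lambda>_::int. tower_group 0)) \<subseteq> {\<one>\<^bsub>sum_group UNIV (\<lambda>_::int. tower_group 0)\<^esub>}"
    by blast
  then show ?thesis
    unfolding 0 by (intro trivial_embeds sum_group group_tower_group)
next
  case (Suc k)
  let ?W = "wreath (tower_group k) integer_group"
  let ?V = "sum_group UNIV (\<lambda>_::int. ?W)"
  have "embeds (sum_group UNIV (\<lambda>_::int. tower_group (Suc k))) (sum_group UNIV (\<lambda>_::int. ?V))"
    by (rule sum_group_embeds_reindex[where e = "\<lambda>i. i"])
      (simp_all add: group_tower_group group_tower_step tower_group_Suc_embeds del: tower_group.simps)
  moreover have "embeds (sum_group UNIV (\<lambda>_::int. ?V)) ?V"
    by (intro nested_sum_group_embeds group_wreath group_tower_group group_integer_group)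
  moreover have "embeds ?V (tower_group (Suc k))"
    by (intro iso_imp_embeds tower_group_Suc_iso)
  ultimately show ?thesis
    unfolding Suc by (blast intro: embeds_trans)
qed

text \<open>The height \<open>n\<close> in the tower does not enter the target: only the derived length counts. In the
  induction step \<open>wreath_int_subgroup_embeds\<close> is applied to the induction hypothesis twice, once for
  \<open>d\<close> and once for \<open>d - 1\<close>.\<close>

lemma tower_group_absorbs: "absorbs d (tower_group n) (tower_group d)"
proof (induction n arbitrary: d)
  case 0
  show ?case
    unfolding absorbs_def
  proof safe
    fix S assume S: "subgroup S (tower_group 0)"
    then have "S \<subseteq> {\<one>\<^bsub>tower_group 0\<^esub>}"
      using subgroup.subset carrier_tower_group_0 by blast
    then show "embeds ((tower_group 0)\<lparr>carrier := S\<rparr>) (tower_group d)"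
      using group.subgroup_imp_group[OF group_tower_group S]
      by (intro trivial_embeds group_tower_group) (simp_all del: tower_group.simps)
  qed
next
  case (Suc n)
  show ?case
  proof (cases d)
    case 0
    then show ?thesis
      unfolding absorbs_def
      using group.subgroup_imp_group[OF group_tower_group]
      by (auto intro!: trivial_embeds group_tower_group simp del: tower_group.simps)
  next
    case (Suc e)
    let ?W = "wreath (tower_group n) integer_group"
    have 1: "embeds (wreath (sum_group UNIV (\<lambda>_::int. tower_group e)) integer_group) (tower_group (Suc e))"
      using embeds_trans[OF wreath_int_mono[OF sum_tower_group_embeds] wreath_tower_group_embeds]
        group_tower_group by (simp del: tower_group.simps)
    have "absorbs (Suc e) ?W (tower_group (Suc e))"
      unfolding absorbs_def
    proof safe
      fix S assume "subgroup S ?W" "(derived ?W ^^ Suc e) S \<subseteq> {\<one>\<^bsub>?W\<^esub>}"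
      from wreath_int_subgroup_embeds[OF group_tower_group group_tower_group group_tower_group
          Suc.IH Suc.IH this]
      show "embeds (?W\<lparr>carrier := S\<rparr>) (tower_group (Suc e))"
        using 1 sum_tower_group_embeds embeds_trans by metis
    qed
    then have "absorbs (Suc e) (sum_group UNIV (\<lambda>_::int. ?W)) (sum_group UNIV (\<lambda>_::int. tower_group (Suc e)))"
      by (intro absorbs_sum_group group_wreath group_tower_group group_integer_group)
    then have "absorbs (Suc e) (sum_group UNIV (\<lambda>_::int. ?W)) (tower_group (Suc e))"
      by (rule absorbs_embeds_right[OF _ sum_tower_group_embeds])
    then show ?thesis
      unfolding Suc
      by (rule absorbs_embeds_left[OF tower_group_Suc_embeds _ group_tower_group group_tower_step group_tower_group])
  qed
qed

lemma derived_length_tower_group: "derived_length (tower_group n) \<le> enat n"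
proof (induction n)
  case 0
  show ?case
    using group.derived_length_le_iff[OF group_tower_group[of 0], of 0] by (simp add: singleton_group_def)
next
  case (Suc n)
  then have "derived_length (sum_group UNIV (\<lambda>_::int. wreath (tower_group n) integer_group)) \<le> enat (Suc n)"
    by (intro derived_length_sum_group_le derived_length_wreath_int_le group_wreath
        group_tower_group group_integer_group)
  then show ?case
    by (rule derived_length_embeds_le[OF tower_group_Suc_embeds group_tower_group group_tower_step])
qed

lemma bounded_embeds_tower_group:
  assumes "group G" "embeds G (tower_group n)" "derived_length G \<le> enat d"
  shows "embeds G (tower_group d)"
proof -
  have "absorbs d G (tower_group d)"
    using absorbs_embeds_left[OF assms(2) tower_group_absorbs assms(1) group_tower_group group_tower_group] .
  then have "embeds (G\<lparr>carrier := carrier G\<rparr>) (tower_group d)"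
    using assms(3) group.subgroup_self[OF assms(1)]
    unfolding absorbs_def group.derived_length_le_iff[OF assms(1)] by blast
  moreover have "embeds G (G\<lparr>carrier := carrier G\<rparr>)"
    using embeds_refl[of G] by (simp add: embeds_def mon_def hom_def)
  ultimately show ?thesis
    by (rule embeds_trans[rotated])
qed

text \<open>An element is determined by the finite part of its graph with nontrivial values.\<close>

lemma countable_carrier_sum_group:
  assumes "\<And>i. i \<in> I \<Longrightarrow> group (F i)" "countable I" "\<And>i. i \<in> I \<Longrightarrow> countable (carrier (F i))"
  shows "countable (carrier (sum_group I F))"
proof -
  let ?P = "SIGMA i:I. carrier (F i)"
  define gr where "gr b = {(i, b i) | i. i \<in> I \<and> b i \<noteq> \<one>\<^bsub>F i\<^esub>}" for b
  have inj: "inj_on gr (carrier (sum_group I F))"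
  proof (rule inj_onI)
    fix b c assume bc: "b \<in> carrier (sum_group I F)" "c \<in> carrier (sum_group I F)" "gr b = gr c"
    have "b i = c i" if "i \<in> I" for i
      using bc(3) that by (auto simp: gr_def set_eq_iff) metis
    then show "b = c"
      using bc assms(1) by (auto simp: carrier_sum_group intro: PiE_ext)
  qed
  have sub: "gr ` carrier (sum_group I F) \<subseteq> {E. finite E \<and> E \<subseteq> ?P}"
  proof (clarify, rule conjI)
    fix b assume b: "b \<in> carrier (sum_group I F)"
    have "gr b = (\<lambda>i. (i, b i)) ` {i \<in> I. b i \<noteq> \<one>\<^bsub>F i\<^esub>}"
      by (auto simp: gr_def)
    then show "finite (gr b)"
      using finite_support_sum_group[of I F b] assms(1) b by simp
    show "gr b \<subseteq> ?P"
      using b assms(1) by (auto simp: gr_def carrier_sum_group)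
  qed
  have "countable {E. finite E \<and> E \<subseteq> ?P}"
    using assms by (intro countable_Collect_finite_subset countable_SIGMA)
  then show ?thesis
    by (rule countable_image_inj_on[OF countable_subset[OF sub] inj])
qed

lemma countable_tower_group: "countable (carrier (tower_group n))"
proof (induction n)
  case (Suc n)
  have "countable (carrier (wreath (tower_group n) integer_group))"
    using countable_carrier_sum_group[of "UNIV :: int set" "\<lambda>_. tower_group n"] Suc group_tower_group
    by (simp add: wreath_def semidirect_product_def)
  then have "countable (carrier (sum_group UNIV (\<lambda>_::int. wreath (tower_group n) integer_group)))"
    by (intro countable_carrier_sum_group group_wreath group_tower_group group_integer_group) auto
  then show ?case
    by (simp add: image_group_def)
qed simp


section \<open>Isomorphism classes\<close>

lemma iso_class_cong:
  assumes "group G" "group H" "G \<cong> H"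
  shows "iso_class G = (iso_class H :: 'd monoid set)"
proof -
  have "H \<cong> G"
    by (rule group.iso_sym[OF assms(1,3)])
  then have "G \<cong> K \<longleftrightarrow> H \<cong> K" for K :: "'d monoid"
    using iso_trans[of G H K] iso_trans[of H G K] assms(3) by auto
  then show ?thesis
    unfolding iso_class_def by simp
qed

lemma mem_iso_class_self: "group K \<Longrightarrow> K \<in> iso_class K"
  using iso_set_refl[of K] by (auto simp: iso_class_def is_iso_def)

text \<open>This is where the universe \<open>'u\<close> has to be infinite.\<close>

lemma countable_group_copy:
  assumes "group G" "countable (carrier G)" "infinite (UNIV :: 'u set)"
  obtains K :: "'u monoid" where "group K" "G \<cong> K"
proof -
  obtain e :: "nat \<Rightarrow> 'u" where e: "inj e"
    using assms(3) infinite_countable_subset by blast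
  obtain c where c: "inj_on c (carrier G)" "c ` carrier G \<subseteq> (UNIV :: nat set)"
    using assms(2) by (auto simp: countable_def)
  have inj: "inj_on (e \<circ> c) (carrier G)"
    using c e by (auto intro: comp_inj_on inj_on_subset)
  show ?thesis
  proof (rule that)
    show "group (image_group (e \<circ> c) G)"
      by (rule group.inj_imp_image_group_is_group[OF assms(1) inj])
    show "G \<cong> image_group (e \<circ> c) G"
      using inj_imp_image_group_iso[OF inj] by (auto simp: is_iso_def)
  qed
qed

text \<open>The classes on the right-hand side of the main statement, described by groups with carrier in the
  universe \<open>'u\<close> instead of subgroups of the tower; the two descriptions are compared in the theorem.\<close>

definition tower_classes :: "'u monoid set set"
  where "tower_classes = {iso_class K | K :: 'u monoid. group K \<and> (\<exists>n. embeds K (tower_group n))}"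

lemma iso_class_mem_tower_classesI:
  fixes K :: "'u monoid"
  assumes "group K" "embeds K (tower_group n)"
  shows "iso_class K \<in> (tower_classes :: 'u monoid set set)"
  using assms unfolding tower_classes_def by blast

lemma Union_tower_classes_iff:
  fixes K :: "'u monoid"
  shows "K \<in> \<Union>tower_classes \<longleftrightarrow> group K \<and> (\<exists>n. embeds K (tower_group n))"
proof
  assume "K \<in> \<Union>tower_classes"
  then obtain c where c: "K \<in> c" "c \<in> tower_classes" by blast
  then obtain G :: "'u monoid" and n where "group G" "embeds G (tower_group n)" "c = iso_class G"
    unfolding tower_classes_def by blast
  with c(1) have G: "group K" "G \<cong> K" "group G" "embeds G (tower_group n)"
    by (simp_all only: iso_class_def mem_Collect_eq)
  have "embeds K G"
    by (rule iso_imp_embeds[OF group.iso_sym[OF G(3,2)]])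
  then show "group K \<and> (\<exists>n. embeds K (tower_group n))"
    using G(1) embeds_trans[OF _ G(4)] by blast
next
  assume K: "group K \<and> (\<exists>n. embeds K (tower_group n))"
  then have "iso_class K \<in> (tower_classes :: 'u monoid set set)"
    using iso_class_mem_tower_classesI by blast
  moreover have "K \<in> iso_class K"
    using K by (simp add: mem_iso_class_self)
  ultimately show "K \<in> \<Union>tower_classes" by blast
qed

lemma iso_class_mem_tower_classes:
  assumes "infinite (UNIV :: 'u set)" "group G" "embeds G (tower_group n)"
  shows "iso_class G \<in> (tower_classes :: 'u monoid set set)"
proof -
  obtain f where "f \<in> hom G (tower_group n)" "inj_on f (carrier G)"
    using embedsE[OF assms(3,2) group_tower_group] by metis
  then have "countable (carrier G)"
    using countable_subset[OF hom_carrier countable_tower_group] countable_image_inj_on by blast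
  then obtain K :: "'u monoid" where K: "group K" "G \<cong> K"
    using countable_group_copy[OF assms(2) _ assms(1)] by metis
  have eq: "iso_class G = (iso_class K :: 'u monoid set)"
    by (rule iso_class_cong[OF assms(2) K])
  have "embeds K (tower_group n)"
    using embeds_trans[OF iso_imp_embeds[OF group.iso_sym[OF assms(2) K(2)]] assms(3)] .
  then show ?thesis
    unfolding eq by (rule iso_class_mem_tower_classesI[OF K(1)])
qed

text \<open>For bounded sums, the common bound \<open>d\<close> on the derived lengths puts all summands into the same \<open>G\<^sub>d\<close>.\<close>

lemma tower_classes_closed:
  assumes inf: "infinite (UNIV :: 'u set)"
  defines "C \<equiv> (tower_classes :: 'u monoid set set)"
  shows "C \<subseteq> iso_classes" "C \<noteq> {}" "closed_subgroups C" "closed_wreath_int C" "closed_bounded_sums C"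
proof -
  show "C \<subseteq> iso_classes"
    by (auto simp: C_def tower_classes_def iso_classes_def)
  show "C \<noteq> {}"
    using iso_class_mem_tower_classes[OF inf group_tower_group[of 0] embeds_refl] by (auto simp: C_def)
  show "closed_subgroups C"
    unfolding closed_subgroups_def
  proof (intro ballI allI impI)
    fix K S assume "K \<in> \<Union>C" and S: "subgroup S K"
    then obtain n where K: "group K" "embeds K (tower_group n)"
      unfolding C_def Union_tower_classes_iff by blast
    show "iso_class (K\<lparr>carrier := S\<rparr>) \<in> C"
      unfolding C_def
      by (rule iso_class_mem_tower_classes[OF inf group.subgroup_imp_group[OF K(1) S]
            embeds_trans[OF subgroup_embeds[OF S] K(2)]])
  qed
  show "closed_wreath_int C"
    unfolding closed_wreath_int_def
  proof
    fix K assume "K \<in> \<Union>C"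
    then obtain n where K: "group K" "embeds K (tower_group n)"
      unfolding C_def Union_tower_classes_iff by blast
    show "iso_class (wreath K integer_group) \<in> C"
      unfolding C_def
      by (rule iso_class_mem_tower_classes[OF inf group_wreath[OF K(1) group_integer_group]
            embeds_trans[OF wreath_int_mono[OF K(2,1) group_tower_group] wreath_tower_group_embeds]])
  qed
  show "closed_bounded_sums C"
    unfolding closed_bounded_sums_def
  proof (intro allI impI, elim conjE exE)
    fix I :: "nat set" and K :: "nat \<Rightarrow> 'u monoid" and d
    assume "\<forall>i\<in>I. K i \<in> \<Union>C" and dl: "\<forall>i\<in>I. derived_length (K i) \<le> enat d"
    then have K: "\<And>i. i \<in> I \<Longrightarrow> group (K i)" "\<And>i. i \<in> I \<Longrightarrow> \<exists>n. embeds (K i) (tower_group n)"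
      unfolding C_def Union_tower_classes_iff by blast+
    then have emb: "embeds (K i) (tower_group d)" if "i \<in> I" for i
      using bounded_embeds_tower_group dl that by blast
    have "embeds (sum_group I K) (sum_group UNIV (\<lambda>_::int. tower_group d))"
      by (rule sum_group_embeds_reindex[where e = int, OF K(1) group_tower_group emb]) auto
    then have "embeds (sum_group I K) (tower_group d)"
      by (rule embeds_trans[OF _ sum_tower_group_embeds])
    then show "iso_class (sum_group I K) \<in> C"
      unfolding C_def using K(1) by (intro iso_class_mem_tower_classes[OF inf]) auto
  qed
qed

lemma iso_classes_representative:
  fixes C :: "'u monoid set set"
  assumes "C \<subseteq> iso_classes" "iso_class G \<in> C"
  obtains K :: "'u monoid" where "K \<in> \<Union>C" "group K" "G \<cong> K"
proof -
  have "iso_class G \<in> (iso_classes :: 'u monoid set set)"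
    using assms by (rule subsetD)
  then obtain K :: "'u monoid" where "group K" "iso_class G = (iso_class K :: 'u monoid set)"
    unfolding iso_classes_def by blast
  then have K: "K \<in> iso_class G"
    using mem_iso_class_self by blast
  show ?thesis
  proof (rule that)
    show "K \<in> \<Union>C"
      using K assms(2) by blast
    show "group K" "G \<cong> K"
      using K by (simp_all add: iso_class_def)
  qed
qed

text \<open>\<open>G\<close> and \<open>H\<close> may have carriers outside the universe \<open>'u\<close>, for instance be groups of the tower; the
  argument passes to a copy of \<open>G\<close> inside it.\<close>

lemma closed_subgroups_embeds:
  fixes C :: "'u monoid set set"
  assumes C: "C \<subseteq> iso_classes" "closed_subgroups C"
    and G: "group G" "iso_class G \<in> C" and H: "group H" "embeds H G"
  shows "iso_class H \<in> C"
proof -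
  obtain K :: "'u monoid" where K: "K \<in> \<Union>C" "group K" "G \<cong> K"
    using iso_classes_representative[OF C(1) G(2)] .
  have "embeds H K"
    using embeds_trans[OF H(2) iso_imp_embeds[OF K(3)]] .
  then obtain S where S: "subgroup S K" "H \<cong> K\<lparr>carrier := S\<rparr>"
    using embeds_imp_iso_subgroup H(1) K(2) by blast
  have "iso_class H = (iso_class (K\<lparr>carrier := S\<rparr>) :: 'u monoid set)"
    by (rule iso_class_cong[OF H(1) group.subgroup_imp_group[OF K(2) S(1)] S(2)])
  then show ?thesis
    using C(2) K(1) S(1) unfolding closed_subgroups_def by metis
qed

text \<open>Because of closure under subgroups it suffices to find a group in the class into which \<open>G\<^sub>n\<^sub>+\<^sub>1\<close>
  embeds; this avoids comparing it up to isomorphism with sums and wreath products formed in \<open>'u\<close>.\<close>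

lemma tower_group_mem_closed:
  fixes C :: "'u monoid set set"
  assumes C: "C \<subseteq> iso_classes" "C \<noteq> {}" "closed_subgroups C" "closed_wreath_int C" "closed_bounded_sums C"
  shows "iso_class (tower_group n) \<in> C"
proof (induction n)
  case 0
  obtain K :: "'u monoid" where K: "iso_class K \<in> C" "group K"
    using C(1,2) by (auto simp: iso_classes_def)
  show ?case
    by (rule closed_subgroups_embeds[OF C(1,3) K(2,1) group_tower_group])
      (use trivial_embeds[OF group_tower_group K(2) equalityD1[OF carrier_tower_group_0]] in simp)
next
  case (Suc n)
  obtain K :: "'u monoid" where K: "K \<in> \<Union>C" "group K" "tower_group n \<cong> K"
    using iso_classes_representative[OF C(1) Suc.IH] .
  have W: "group (wreath K integer_group)"
    using K(2) by (simp add: group_wreath)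
  have "iso_class (wreath K integer_group) \<in> C"
    using C(4) K(1) unfolding closed_wreath_int_def by (rule bspec)
  then obtain L :: "'u monoid" where L: "L \<in> \<Union>C" "group L" "wreath K integer_group \<cong> L"
    using iso_classes_representative[OF C(1)] by blast
  have "derived_length K \<le> enat n"
    by (rule derived_length_embeds_le[OF _ K(2) group_tower_group derived_length_tower_group])
      (intro iso_imp_embeds group.iso_sym[OF group_tower_group] K(3))
  then have "derived_length (wreath K integer_group) \<le> enat (Suc n)"
    by (rule derived_length_wreath_int_le[OF K(2)])
  then have "derived_length L \<le> enat (Suc n)"
    by (rule derived_length_embeds_le[OF iso_imp_embeds[OF group.iso_sym[OF W L(3)]] L(2) W])
  then have sum: "iso_class (sum_group (UNIV :: nat set) (\<lambda>_. L)) \<in> C"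
    using C(5)[unfolded closed_bounded_sums_def, THEN spec, THEN spec, THEN mp, of UNIV "\<lambda>_. L"] L(1)
    by fast
  have "embeds (wreath (tower_group n) integer_group) L"
    using embeds_trans[OF wreath_int_mono[OF iso_imp_embeds[OF K(3)] group_tower_group K(2)]
        iso_imp_embeds[OF L(3)]] .
  then have "embeds (sum_group UNIV (\<lambda>_::int. wreath (tower_group n) integer_group)) (sum_group (UNIV :: nat set) (\<lambda>_. L))"
    using L(2) by (intro sum_group_embeds_reindex[where e = int_encode] group_wreath group_tower_group
        group_integer_group inj_int_encode) auto
  then have "embeds (tower_group (Suc n)) (sum_group (UNIV :: nat set) (\<lambda>_. L))"
    by (rule embeds_trans[OF tower_group_Suc_embeds])
  then show ?case
    using L(2) by (intro closed_subgroups_embeds[OF C(1,3) _ sum group_tower_group]) auto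
qed

theorem theorem1p2:
  fixes H :: "'u monoid set"
  assumes "infinite (UNIV :: 'u set)"
    and "H \<in> iso_classes"
  shows "H \<in> class_R \<longleftrightarrow>
    (\<exists>G\<in>class_M. \<exists>S. subgroup S G \<and> H = iso_class (G\<lparr>carrier := S\<rparr>))"
proof
  assume "H \<in> class_R"
  then have "H \<in> tower_classes"
    using tower_classes_closed[OF assms(1)] unfolding class_R_def by blast
  then obtain K :: "'u monoid" and n where K: "H = iso_class K" "group K" "embeds K (tower_group n)"
    by (auto simp: tower_classes_def)
  obtain S where S: "subgroup S (tower_group n)" "K \<cong> (tower_group n)\<lparr>carrier := S\<rparr>"
    using embeds_imp_iso_subgroup[OF K(3,2) group_tower_group] .
  have "H = iso_class ((tower_group n)\<lparr>carrier := S\<rparr>)"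
    unfolding K(1)
    by (rule iso_class_cong[OF K(2) group.subgroup_imp_group[OF group_tower_group S(1)] S(2)])
  then show "\<exists>G\<in>class_M. \<exists>S. subgroup S G \<and> H = iso_class (G\<lparr>carrier := S\<rparr>)"
    using S(1) by (auto simp: class_M_def)
next
  assume "\<exists>G\<in>class_M. \<exists>S. subgroup S G \<and> H = iso_class (G\<lparr>carrier := S\<rparr>)"
  then obtain n S where S: "subgroup S (tower_group n)" "H = iso_class ((tower_group n)\<lparr>carrier := S\<rparr>)"
    by (auto simp: class_M_def)
  have "H \<in> C" if "C \<subseteq> iso_classes" "C \<noteq> {}" "closed_subgroups C" "closed_wreath_int C"
    "closed_bounded_sums C" for C
    unfolding S(2)
    using closed_subgroups_embeds[OF that(1,3) group_tower_group tower_group_mem_closed[OF that]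
        group.subgroup_imp_group[OF group_tower_group S(1)] subgroup_embeds[OF S(1)]] .
  then show "H \<in> class_R"
    unfolding class_R_def by blast
qed

end
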